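(* Outer billiards on the Penrose kite $K$ has an unbounded orbit. In fact, both the forwards and the backwards outer billiards orbits of the point $p$ are entirely defined and unbounded, where $p=F^{-1}(\phi^{-2},-1)$ and $F$ is the orientation-preserving affine map of the plane carrying $K$ to the kite with vertices $(0,1),(-1,0),(0,-1),(\phi^{-3},0)$.
   Context: $\phi=(1+\sqrt5)/2$ is the golden ratio. The Penrose kite $K$ is the convex quadrilateral of the Penrose tiling: a kite with interior angles $72^\circ,72^\circ,72^\circ,144^\circ$ (the angle $144^\circ$ is opposite a $72^\circ$ angle on the axis of symmetry). It is affinely equivalent to the convex quadrilateral $S$ with vertices $(0,1),(-1,0),(0,-1),(\phi^{-3},0)$, and $F$ is the unique orientation-preserving affine bijection of $\mathbb{R}^2$ with $F(K)=S$. Outer billiards: for a bounded convex set $S\subset\mathbb{R}^2$ and $x_0\in\mathbb{R}^2-S$, the outer billiards map sends $x_0$ to the point $x_1$ such that the segment $\overline{x_0x_1}$ is tangent to $S$ at its midpoint and $S$ lies to the right of the ray $\overrightarrow{x_0x_1}$. It is undefined at $x_0$ if the segment $\overline{x_0x_1}$ is tangent to $S$ along a nondegenerate segment. The forwards orbit of $x_0$ is the sequence $x_0\to x_1\to x_2\to\cdots$ of iterates; the backwards orbit is defined similarly using the inverse map (i.e. with $S$ to the left of the ray). An orbit is entirely defined if all iterates are defined. Outer billiards commutes with orientation-preserving affine maps. *)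

theory Defs
  imports "HOL-Analysis.Analysis"
begin

definition golden_ratio :: real where
  "golden_ratio = (1 + sqrt 5) / 2"

definition angle :: "real^2 \<Rightarrow> real^2 \<Rightarrow> real^2 \<Rightarrow> real" where
  "angle a b c = arccos (((a - b) \<bullet> (c - b)) / (norm (a - b) * norm (c - b)))"

text \<open>The vertices are listed in cyclic order (in either direction): a quadrilateral is convex
  and nondegenerate iff its diagonals cross at a point interior to both and no three vertices
  are collinear.\<close>

definition convex_quadrilateral :: "real^2 \<Rightarrow> real^2 \<Rightarrow> real^2 \<Rightarrow> real^2 \<Rightarrow> bool" where
  "convex_quadrilateral a b c d \<longleftrightarrow>
     \<not> collinear {a, b, c} \<and> \<not> collinear {b, c, d} \<and>
     \<not> collinear {c, d, a} \<and> \<not> collinear {d, a, b} \<and>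
     open_segment a c \<inter> open_segment b d \<noteq> {}"

text \<open>The Penrose kite is determined up to similarity, so it is a predicate on subsets of the plane.
  The axis of symmetry is the line through \<open>a\<close> and \<open>c\<close>.\<close>

definition is_penrose_kite :: "(real^2) set \<Rightarrow> bool" where
  "is_penrose_kite K \<longleftrightarrow>
     (\<exists>a b c d. K = convex hull {a, b, c, d} \<and> convex_quadrilateral a b c d \<and>
        dist a b = dist a d \<and> dist c b = dist c d \<and>
        angle d a b = 2 * pi / 5 \<and> angle a b c = 2 * pi / 5 \<and>
        angle c d a = 2 * pi / 5 \<and> angle b c d = 4 * pi / 5)"

lemma penrose_kite_exists: "\<exists>K. is_penrose_kite K"
proof -
  define C where "C = cos (pi / 5)"
  define s where "s = sin (pi / 5)"
  define a b c d :: "real^2"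
    where "a = vector [0, 0]" and "b = vector [C, s]" and "c = vector [1, 0]" and "d = vector [C, - s]"
  note abcd = a_def b_def c_def d_def
  have cs: "C\<^sup>2 + s\<^sup>2 = 1" by (simp add: C_def s_def)
  have s0: "s > 0" unfolding s_def by (rule sin_gt_zero) (auto simp: pi_gt_zero)
  have C0: "C > 0" unfolding C_def by (rule cos_gt_zero) (auto simp: pi_gt_zero)
  have C1: "C < 1"
  proof -
    have "s\<^sup>2 > 0" using s0 by simp
    then have "C\<^sup>2 < 1\<^sup>2" using cs unfolding power_one by linarith
    then show ?thesis by (rule power2_less_imp_less) simp
  qed
  have ss: "s * s = 1 - C * C" using cs by (simp add: power2_eq_square)
  have "norm b = 1" "norm d = 1"
    using cs by (simp_all add: abcd norm_vec_def L2_set_def sum_2)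
  moreover have n2: "norm (b - c) = sqrt (2 - 2 * C)" "norm (d - c) = sqrt (2 - 2 * C)"
    by (simp_all add: abcd norm_vec_def L2_set_def sum_2 power2_eq_square algebra_simps ss)
  moreover have "a = 0" by (simp add: a_def vec_eq_iff forall_2)
  ultimately have norms: "norm (b - a) = 1" "norm (a - b) = 1" "norm (d - a) = 1" "norm (a - d) = 1"
    "norm (c - b) = sqrt (2 - 2 * C)" "norm (c - d) = sqrt (2 - 2 * C)"
    by (simp_all add: norm_minus_commute)
  have half: "(1 - C) / sqrt (2 - 2 * C) = cos (2 * pi / 5)"
  proof -
    have e: "C = 1 - 2 * (sin (pi / 10))\<^sup>2"
      using cos_double_sin[of "pi / 10"] by (simp add: C_def)
    have p: "sin (pi / 10) > 0" by (rule sin_gt_zero) (auto simp: pi_gt_zero)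
    have "sqrt (2 - 2 * C) = sqrt ((2 * sin (pi / 10))\<^sup>2)"
      by (rule arg_cong[of _ _ sqrt]) (simp add: e power_mult_distrib)
    also have "\<dots> = 2 * sin (pi / 10)" unfolding real_sqrt_abs using p by linarith
    finally have "(1 - C) / sqrt (2 - 2 * C) = sin (pi / 10)"
      using p by (simp add: e power2_eq_square)
    also have "\<dots> = cos (pi / 2 - pi / 10)" by (simp only: sin_cos_eq of_real_eq_id id_apply)
    also have "pi / 2 - pi / 10 = 2 * pi / 5" by simp
    finally show ?thesis .
  qed
  have ac: "arccos (cos (2 * pi / 5)) = 2 * pi / 5" "arccos (cos (4 * pi / 5)) = 4 * pi / 5"
    by (rule arccos_cos; simp add: pi_gt_zero)+
  have A: "angle d a b = 2 * pi / 5"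
  proof -
    have "(d - a) \<bullet> (b - a) = cos (2 * (pi / 5))"
      unfolding cos_double by (simp add: abcd inner_vec_def sum_2 C_def s_def power2_eq_square)
    then show ?thesis using ac by (simp add: angle_def norms)
  qed
  have B: "angle a b c = 2 * pi / 5" "angle c d a = 2 * pi / 5"
  proof -
    have "(a - b) \<bullet> (c - b) = 1 - C" "(c - d) \<bullet> (a - d) = 1 - C"
      by (simp_all add: abcd inner_vec_def sum_2 algebra_simps ss)
    then show "angle a b c = 2 * pi / 5" "angle c d a = 2 * pi / 5"
      using ac half by (simp_all add: angle_def norms)
  qed
  have D: "angle b c d = 4 * pi / 5"
  proof -
    have "(b - c) \<bullet> (d - c) = - C * (2 - 2 * C)"
      by (simp add: abcd inner_vec_def sum_2 algebra_simps ss)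
    then have "(b - c) \<bullet> (d - c) / (norm (b - c) * norm (d - c)) = - C"
      using C1 by (simp add: n2)
    also have "- C = cos (pi - pi / 5)" unfolding C_def by (rule cos_pi_minus[symmetric])
    also have "pi - pi / 5 = 4 * pi / 5" by simp
    finally show ?thesis using ac by (simp add: angle_def)
  qed
  have col: "u$1 * v$2 = u$2 * v$1" if "collinear {0, u, v}" for u v :: "real^2"
    using that by (auto simp: collinear_lemma)
  have nc: "\<not> collinear {x, y, z}" if "(y - x)$1 * (z - x)$2 \<noteq> (y - x)$2 * (z - x)$1"
    for x y z :: "real^2"
  proof
    assume "collinear {x, y, z}"
    then have "collinear {y, x, z}" by (simp add: insert_commute)
    then have "collinear {0, y - x, z - x}" using collinear_3[of y x z] by simp
    from col[OF this] show False using that by simp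
  qed
  have "convex_quadrilateral a b c d"
    unfolding convex_quadrilateral_def
  proof (intro conjI)
    show "\<not> collinear {a, b, c}" "\<not> collinear {b, c, d}" "\<not> collinear {c, d, a}" "\<not> collinear {d, a, b}"
      using s0 C0 C1 by (auto intro!: nc simp: abcd algebra_simps)
    have "vector [C, 0] \<in> open_segment a c" "vector [C, 0] \<in> open_segment b d"
      using s0 C0 C1
      by (auto simp: in_segment abcd vec_eq_iff forall_2 intro: exI[of _ C] exI[of _ "1/2"])
    then show "open_segment a c \<inter> open_segment b d \<noteq> {}" by blast
  qed
  moreover have "dist a b = dist a d" "dist c b = dist c d"
    using norms by (simp_all add: dist_norm)
  ultimately show ?thesis unfolding is_penrose_kite_def using A B D by blast
qed

definition orientation_preserving_affine :: "(real^2 \<Rightarrow> real^2) \<Rightarrow> bool" where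
  "orientation_preserving_affine F \<longleftrightarrow>
     (\<exists>(A :: real^2^2) b. det A > 0 \<and> F = (\<lambda>x. A *v x + b))"

definition normalized_kite :: "(real^2) set" where
  "normalized_kite =
     convex hull {vector [0, 1], vector [-1, 0], vector [0, -1], vector [1 / golden_ratio ^ 3, 0]}"

text \<open>Nonpositivity of the determinant says that \<open>z\<close> lies on the ray's line or to its right.\<close>

definition weakly_right_of_ray :: "real^2 \<Rightarrow> real^2 \<Rightarrow> real^2 \<Rightarrow> bool" where
  "weakly_right_of_ray x y z \<longleftrightarrow> det (vector [y - x, z - x] :: real^2^2) \<le> 0"

text \<open>\<open>outer_billiards S x y\<close> is the graph of the partial map sending \<open>x\<close> to \<open>y\<close>.
  Requiring the segment to meet \<open>S\<close> in its midpoint only leaves the map undefined where the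
  segment is tangent along a nondegenerate segment.\<close>

definition outer_billiards :: "(real^2) set \<Rightarrow> real^2 \<Rightarrow> real^2 \<Rightarrow> bool" where
  "outer_billiards S x y \<longleftrightarrow>
     x \<notin> S \<and> closed_segment x y \<inter> S = {midpoint x y} \<and> (\<forall>z\<in>S. weakly_right_of_ray x y z)"

lemma det_vector_2: "det (vector [u, v] :: real^2^2) = u$1 * v$2 - u$2 * v$1"
  by (simp add: det_2)

lemma outer_billiards_unique:
  assumes "convex S" "outer_billiards S x y" "outer_billiards S x y'"
  shows "y = y'"
proof -
  define m where "m = midpoint x y"
  define m' where "m' = midpoint x y'"
  have y: "y = x + 2 *\<^sub>R (m - x)" and y': "y' = x + 2 *\<^sub>R (m' - x)"
    by (simp_all add: m_def m'_def midpoint_def scaleR_2 algebra_simps)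
  have xS: "x \<notin> S" and seg: "closed_segment x y \<inter> S = {m}" "closed_segment x y' \<inter> S = {m'}"
    using assms by (auto simp: outer_billiards_def m_def m'_def)
  have mS: "m \<in> S" "m' \<in> S" using seg by auto
  have ne: "m \<noteq> x" "m' \<noteq> x" using mS xS by auto
  have "weakly_right_of_ray x y m'" "weakly_right_of_ray x y' m"
    using assms mS by (auto simp: outer_billiards_def)
  then have cr: "(m - x)$1 * (m' - x)$2 = (m - x)$2 * (m' - x)$1"
    by (simp add: weakly_right_of_ray_def det_vector_2 y y' algebra_simps)
  have "\<exists>t. v = t *\<^sub>R u" if "u \<noteq> 0" "u$1 * v$2 = u$2 * v$1" for u v :: "real^2"
  proof (cases "u$1 = 0")
    case True
    then have "u$2 \<noteq> 0" using that by (auto simp: vec_eq_iff forall_2)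
    then show ?thesis using True that
      by (intro exI[of _ "v$2 / u$2"]) (auto simp: vec_eq_iff forall_2)
  next
    case False
    then show ?thesis using that
      by (intro exI[of _ "v$1 / u$1"]) (auto simp: vec_eq_iff forall_2 field_simps)
  qed
  from this[OF _ cr] have "\<exists>t. m' - x = t *\<^sub>R (m - x)" using ne by simp
  then obtain t where t: "m' - x = t *\<^sub>R (m - x)" by blast
  then have t0: "t \<noteq> 0" using ne by auto
  have m'eq: "m' = x + t *\<^sub>R (m - x)" using t by (simp add: algebra_simps)
  consider "t < 0" | "0 < t" "t \<le> 2" | "t > 2" using t0 by linarith
  then have "m' = m"
  proof cases
    case 1
    have "(1 - 1 / (1 - t)) *\<^sub>R m + (1 / (1 - t)) *\<^sub>R m' =
        x + (1 - 1 / (1 - t) + 1 / (1 - t) * t) *\<^sub>R (m - x)"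
      unfolding m'eq by (simp add: algebra_simps)
    also have "1 - 1 / (1 - t) + 1 / (1 - t) * t = 0" using 1 by (simp add: field_simps)
    finally have "x = (1 - 1 / (1 - t)) *\<^sub>R m + (1 / (1 - t)) *\<^sub>R m'" by simp
    moreover have "1 / (1 - t) \<ge> 0" "1 / (1 - t) \<le> 1" using 1 by auto
    ultimately have "x \<in> closed_segment m m'" unfolding in_segment by blast
    then show ?thesis using xS mS \<open>convex S\<close> convex_contains_segment by blast
  next
    case 2
    have "m' \<in> closed_segment x y" unfolding in_segment
      using 2 by (intro exI[of _ "t / 2"]) (auto simp: m'eq y algebra_simps)
    then show ?thesis using seg mS by auto
  next
    case 3
    have "m \<in> closed_segment x y'" unfolding in_segment
      using 3 by (intro exI[of _ "1 / (2 * t)"]) (auto simp: m'eq y' algebra_simps)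
    then show ?thesis using seg mS by auto
  qed
  then show ?thesis by (simp add: y y')
qed

lemma inverse_outer_billiards_iff:
  "(outer_billiards S)\<inverse>\<inverse> x y \<longleftrightarrow>
     x \<notin> S \<and> closed_segment x y \<inter> S = {midpoint x y} \<and>
     (\<forall>z\<in>S. det (vector [y - x, z - x] :: real^2^2) \<ge> 0)"
proof -
  have *: "x \<notin> S \<longleftrightarrow> y \<notin> S" if "closed_segment x y \<inter> S = {midpoint x y}"
  proof -
    have "x \<in> S \<longleftrightarrow> x = midpoint x y" "y \<in> S \<longleftrightarrow> y = midpoint x y"
      using that by auto
    then show ?thesis by (metis midpoint_eq_endpoint)
  qed
  have "det (vector [x - y, z - y] :: real^2^2) = - det (vector [y - x, z - x] :: real^2^2)" for z
    by (simp add: det_vector_2 algebra_simps)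
  with * show ?thesis
    by (auto simp: outer_billiards_def weakly_right_of_ray_def closed_segment_commute midpoint_sym)
qed

text \<open>For a functional relation \<open>R\<close> the sequence \<open>X\<close> is unique: it is the orbit of \<open>p\<close>, and its
  existence says that every iterate is defined. Backwards orbits of \<open>outer_billiards S\<close> are
  orbits of the converse relation.\<close>

definition unbounded_orbit :: "(real^2 \<Rightarrow> real^2 \<Rightarrow> bool) \<Rightarrow> real^2 \<Rightarrow> bool" where
  "unbounded_orbit R p \<longleftrightarrow>
     (\<exists>X. X 0 = p \<and> (\<forall>n. R (X n) (X (Suc n))) \<and> \<not> bounded (range X))"

end

theory Submission
  imports Defs
begin

text \<open>Outer billiards commutes with orientation-preserving affine maps, so everything reduces to the
  normalized kite, whose vertices north, west, south and east are \<open>(0, 1)\<close>,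
  \<open>(-1, 0)\<close>, \<open>(0, -1)\<close> and \<open>(t, 0)\<close> with \<open>t =
  \<phi>\<^sup>-\<^sup>3 = 2\<phi> - 3\<close>. A partial injective map has an unbounded,
  everywhere defined orbit through \<open>p\<close> as soon as the set of points reachable from
  \<open>p\<close> is unbounded (\<open>unbounded_orbit_of_reachable\<close>), so it suffices to
  exhibit points arbitrarily far away that lie on the forward orbit of \<open>p =
  (\<phi>\<^sup>-\<^sup>2, -1)\<close>, and others that lie on its backward orbit.

  Two consecutive reflections in vertices compose to a translation by twice the difference of
  these vertices. Along the orbit of a point on one of the lines \<open>y = 1\<close> and
  \<open>y = -1\<close> the ordinate stays an odd integer, and the translations come in five
  blocks, one for each pair of vertices that is met during half a revolution. Each of the first
  four blocks ends in a strip along an edge of the kite whose width is exactly one translation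
  step, and the last one ends on the two lines. Hence a half turn around the kite takes
  \<open>(x, \<plusminus>1)\<close> to another such point on the other side of the kite, and the
  new abscissa is given by integer parts of linear forms (\<open>upper_half_turn\<close>,
  \<open>lower_half_turn\<close>).

  For abscissas in the ring of golden integers \<open>a + b\<phi>\<close>, a point is described
  by four integers and the integer parts depend on the four bounded forms \<open>form_A\<close>
  to \<open>form_D\<close> only, while the abscissa itself is unbounded, being a combination of
  the integer coefficients of these forms (\<open>half_turn_reaches\<close>). In these
  coordinates the linear part of a half turn is an involution. A full turn is therefore a
  piecewise translation of the forms: the translation vector is constant on polygons whose sides
  have four directions (\<open>leads_full_turn\<close>).

  This polygon exchange renormalizes. There are 29 polygons near \<open>p\<close>, each with a
  displacement that the orbit realizes on it by full turns, such that the picture contracted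
  towards \<open>p\<close> by \<open>\<theta> = 3 - 2\<phi> = -\<phi>\<^sup>-\<^sup>3\<close> is
  realized in turn by words in the 29 displacements. By induction on \<open>k\<close> the
  displacements scaled by \<open>\<theta>\<^sup>k\<close> are realized on the polygons scaled by
  \<open>\<theta>\<^sup>k\<close> (\<open>pieces_lead\<close>). Scaling the forms by
  \<open>\<theta>\<close> is an integer linear map whose effect on abscissas is governed by the
  conjugate of \<open>\<theta>\<close>, which is \<open>\<phi>\<^sup>3\<close>: while the
  displaced points approach \<open>p\<close> in the forms, their abscissas escape geometrically.
  The centre \<open>p\<close> of the contraction lies in one of the polygons, which gives the
  forward orbit, and it is the end point of the displacement of another, which gives the
  backward orbit. The inclusions between polygons are finitely many inequalities between golden
  integers, decided by the sign of a norm.\<close>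

section \<open>Unbounded orbits of partial maps\<close>

text \<open>Functionality makes the reachable points a single sequence. If this sequence stopped, only
  finitely many points would be reachable, so it is infinite, and it exhausts the reachable set.\<close>

lemma unbounded_orbit_of_reachable:
  assumes functional: "\<And>x y y'. R x y \<Longrightarrow> R x y' \<Longrightarrow> y = y'"
    and far: "\<not> bounded {y. R\<^sup>*\<^sup>* p y}"
  shows "unbounded_orbit R p"
proof -
  define next_pt where "next_pt x = (SOME y. R x y)" for x
  define X where "X n = (next_pt ^^ n) p" for n
  have next_eq: "next_pt x = y" if "R x y" for x y
    unfolding next_pt_def using that functional by (blast intro: some_equality)
  have on_orbit: "y \<in> range X" if "R\<^sup>*\<^sup>* p y" for y
    using that
  proof (induction rule: rtranclp_induct)
    case base
    show ?case by (rule range_eqI[of _ _ 0]) (simp add: X_def)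
  next
    case (step y z)
    then obtain n where "y = X n" by blast
    with step next_eq have "z = X (Suc n)" by (simp add: X_def)
    then show ?case by blast
  qed
  have steps: "R (X n) (X (Suc n))" for n
  proof (rule ccontr)
    assume stuck: "\<not> R (X n) (X (Suc n))"
    then have no_next: "\<not> R (X n) y" for y
      using next_eq[of "X n" y] by (auto simp: X_def)
    have "y \<in> X ` {..n}" if "R\<^sup>*\<^sup>* p y" for y
      using that
    proof (induction rule: rtranclp_induct)
      case base
      show ?case by (rule image_eqI[of _ _ 0]) (simp_all add: X_def)
    next
      case (step y z)
      then obtain i where i: "i \<le> n" "y = X i" by auto
      with step no_next have "i \<noteq> n" by auto
      moreover have "z = X (Suc i)" using step i next_eq by (simp add: X_def)
      ultimately show ?case using i by (auto intro!: imageI)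
    qed
    then have "{y. R\<^sup>*\<^sup>* p y} \<subseteq> X ` {..n}" by blast
    then have "finite {y. R\<^sup>*\<^sup>* p y}" by (rule finite_subset) simp
    then have "bounded {y. R\<^sup>*\<^sup>* p y}" by (rule finite_imp_bounded)
    with far show False by simp
  qed
  have "\<not> bounded (range X)"
    using far bounded_subset[of "range X" "{y. R\<^sup>*\<^sup>* p y}"] on_orbit by blast
  moreover have "X 0 = p" by (simp add: X_def)
  ultimately show ?thesis unfolding unbounded_orbit_def using steps by blast
qed

section \<open>Reversing the outer billiards map\<close>

text \<open>The reflection in the first coordinate axis reverses orientation, so it conjugates outer
  billiards to the inverse map of the mirror image. This transfers uniqueness to the backward
  direction.\<close>

definition mirror :: "real^2 \<Rightarrow> real^2" where
  "mirror x = vector [x$1, - x$2]"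

lemma mirror_simps [simp]: "mirror x $ 1 = x $ 1" "mirror x $ 2 = - x $ 2"
  by (simp_all add: mirror_def)

lemma mirror_mirror [simp]: "mirror (mirror x) = x"
  by (simp add: vec_eq_iff forall_2)

lemma linear_mirror: "linear mirror"
  by (rule linearI) (simp_all add: vec_eq_iff forall_2)

lemma mirror_mem_iff: "mirror x \<in> mirror ` S \<longleftrightarrow> x \<in> S"
  by (metis image_iff mirror_mirror)

lemma inverse_outer_billiards_mirror:
  "(outer_billiards S)\<inverse>\<inverse> x y \<longleftrightarrow> outer_billiards (mirror ` S) (mirror x) (mirror y)"
proof -
  have seg: "closed_segment (mirror x) (mirror y) \<inter> mirror ` S = {midpoint (mirror x) (mirror y)} \<longleftrightarrow>
      closed_segment x y \<inter> S = {midpoint x y}"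
  proof -
    have m: "midpoint (mirror x) (mirror y) = mirror (midpoint x y)"
      by (rule midpoint_linear_image[OF linear_mirror])
    have inj: "inj mirror" by (metis injI mirror_mirror)
    have "closed_segment (mirror x) (mirror y) \<inter> mirror ` S = mirror ` (closed_segment x y \<inter> S)"
      unfolding closed_segment_linear_image[OF linear_mirror] image_Int[OF inj] ..
    moreover have "{mirror (midpoint x y)} = mirror ` {midpoint x y}" by simp
    ultimately show ?thesis unfolding m by (simp only: inj_image_eq_iff[OF inj])
  qed
  show ?thesis
    unfolding inverse_outer_billiards_iff outer_billiards_def seg weakly_right_of_ray_def
    by (auto simp: mirror_mem_iff det_vector_2 algebra_simps)
qed

lemma inverse_outer_billiards_unique:
  assumes "convex S" "(outer_billiards S)\<inverse>\<inverse> x y" "(outer_billiards S)\<inverse>\<inverse> x y'"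
  shows "y = y'"
proof -
  have "convex (mirror ` S)" using assms(1) linear_mirror by (rule convex_linear_image[rotated])
  then have "mirror y = mirror y'"
    using assms(2,3) outer_billiards_unique unfolding inverse_outer_billiards_mirror by blast
  then show ?thesis by (metis mirror_mirror)
qed

section \<open>The golden ratio\<close>

lemma golden_ratio_square: "golden_ratio * golden_ratio = golden_ratio + 1"
proof -
  have "sqrt 5 * sqrt 5 = (5::real)" by simp
  then show ?thesis unfolding golden_ratio_def by (simp add: field_simps)
qed

lemma golden_ratio_bounds: "16180/10000 < golden_ratio" "golden_ratio < 16181/10000"
proof -
  have "22360/10000 < sqrt (5::real)" by (rule real_less_rsqrt) (simp add: power2_eq_square)
  moreover have "sqrt (5::real) < 22362/10000" by (rule real_less_lsqrt) (simp_all add: power2_eq_square)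
  ultimately show "16180/10000 < golden_ratio" "golden_ratio < 16181/10000"
    unfolding golden_ratio_def by simp_all
qed

text \<open>Rewriting with both equations brings any polynomial in the golden ratio to the form \<open>a +
  b\<phi>\<close>; the second one is needed because products are nested to the right.\<close>

lemma golden_ratio_reduce:
  "golden_ratio * golden_ratio = golden_ratio + 1"
  "golden_ratio * (golden_ratio * t) = golden_ratio * t + t"
  by (rule golden_ratio_square) (simp add: golden_ratio_square distrib_right flip: mult.assoc)

text \<open>If \<open>p + q\<phi> = 0\<close> then \<open>(2p + q)\<^sup>2 = 5q\<^sup>2\<close>, and the
  prime 5 occurs to an even power on the left and to an odd power on the right unless both sides
  vanish.\<close>

lemma golden_ratio_eq_zero_iff:
  fixes p q :: int
  shows "p + q * golden_ratio = 0 \<longleftrightarrow> p = 0 \<and> q = 0"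
proof
  assume 0: "p + q * golden_ratio = 0"
  define n where "n = 2 * p + q"
  have "real_of_int n = - q * sqrt 5"
    using 0 by (simp add: n_def golden_ratio_def field_simps)
  then have "(real_of_int n)\<^sup>2 = (- q * sqrt 5)\<^sup>2" by simp
  then have "real_of_int (n\<^sup>2) = real_of_int (5 * q\<^sup>2)" by (simp add: power_mult_distrib)
  then have eq: "n\<^sup>2 = 5 * q\<^sup>2" by linarith
  have "q = 0"
  proof (rule ccontr)
    assume q: "q \<noteq> 0"
    then have n0: "n \<noteq> 0" using eq by auto
    have "prime (5::int)" by simp
    then have "multiplicity 5 (n\<^sup>2) = 2 * multiplicity 5 n" "multiplicity 5 (5 * q\<^sup>2) = Suc (2 * multiplicity 5 q)"
      using q n0 by (simp_all add: prime_elem_multiplicity_power_distrib prime_elem_multiplicity_mult_distrib)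
    then have "2 * multiplicity 5 n = Suc (2 * multiplicity 5 q)" using eq by simp
    then show False by presburger
  qed
  then show "p = 0 \<and> q = 0" using 0 by simp
qed simp

text \<open>Orbits avoid the lines on which outer billiards is undefined for a parity reason: all relevant
  quantities are golden integers whose coefficient of \<open>\<phi>\<close> is odd. So weak
  inequalities, which are convenient for closed polygons, imply strict ones.\<close>

lemma golden_strict:
  fixes p q :: int
  assumes "0 \<le> p + q * golden_ratio" "odd q"
  shows "0 < p + q * golden_ratio"
  using assms golden_ratio_eq_zero_iff[of p q] by (cases "p + q * golden_ratio = 0") auto

section \<open>The normalized kite\<close>

text \<open>The distance \<open>\<phi>\<^sup>-\<^sup>3\<close> of the east vertex from the crossing point of
  the diagonals.\<close>

definition tail_length :: real where
  "tail_length = 2 * golden_ratio - 3"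

lemma tail_length_eq: "1 / golden_ratio ^ 3 = tail_length"
proof -
  have "golden_ratio ^ 3 * tail_length = 1"
    unfolding tail_length_def power3_eq_cube using golden_ratio_square by algebra
  moreover have "golden_ratio ^ 3 \<noteq> 0" using golden_ratio_bounds by simp
  ultimately show ?thesis by (simp add: field_simps)
qed

lemma tail_length_square: "tail_length * tail_length = 1 - 4 * tail_length"
  unfolding tail_length_def using golden_ratio_square by algebra

lemma tail_length_bounds: "236/1000 < tail_length" "tail_length < 2362/10000"
  using golden_ratio_bounds by (simp_all add: tail_length_def)

abbreviation pt :: "real \<Rightarrow> real \<Rightarrow> real^2" where
  "pt x y \<equiv> vector [x, y]"

lemma pt_eta: "pt (x $ 1) (x $ 2) = x"
  by (simp add: vec_eq_iff forall_2)

lemma normalized_kite_eq: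
  "normalized_kite = convex hull {pt 0 1, pt (-1) 0, pt 0 (-1), pt tail_length 0}"
  by (simp add: normalized_kite_def tail_length_eq)

section \<open>Affine equivariance\<close>

lemma affine_inverse:
  fixes A :: "real^2^2"
  assumes "det A > 0" "F = (\<lambda>x. A *v x + b)"
  obtains B where "det B > 0" "inv F = (\<lambda>x. B *v x + - (B *v b))" "A ** B = mat 1" "B ** A = mat 1" "bij F"
proof -
  have "invertible A" using assms(1) by (simp add: invertible_det_nz)
  then obtain B where B: "A ** B = mat 1" "B ** A = mat 1" unfolding invertible_def by blast
  define G where "G = (\<lambda>x. B *v x + - (B *v b))"
  have "det A * det B = 1" using B(1) det_mul[of A B] by (simp add: det_I)
  then have "det B > 0" using assms(1) by (metis zero_less_mult_pos zero_less_one)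
  moreover have GF: "G (F x) = x" for x
    by (simp add: G_def assms(2) matrix_vector_right_distrib matrix_vector_mul_assoc B)
  have FG: "F (G x) = x" for x
  proof -
    have "F (G x) = A *v (B *v (x - b)) + b"
      by (simp add: G_def assms(2) matrix_vector_mult_diff_distrib)
    then show ?thesis by (simp add: matrix_vector_mul_assoc B)
  qed
  have "bij F" using GF FG by (metis bijI' )
  moreover have "inv F = G" using GF FG by (metis inv_unique_comp comp_def ext id_apply)
  ultimately show thesis using that B unfolding G_def by blast
qed

lemma orientation_preserving_affine_bij:
  "orientation_preserving_affine F \<Longrightarrow> bij F"
  unfolding orientation_preserving_affine_def by (metis affine_inverse)

lemma orientation_preserving_affine_inv:
  "orientation_preserving_affine F \<Longrightarrow> orientation_preserving_affine (inv F)"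
  unfolding orientation_preserving_affine_def by (metis affine_inverse)

lemma orientation_preserving_affine_comp:
  assumes "orientation_preserving_affine F" "orientation_preserving_affine G"
  shows "orientation_preserving_affine (F \<circ> G)"
proof -
  obtain A b where F: "det A > 0" "F = (\<lambda>x. A *v x + b)"
    using assms(1) unfolding orientation_preserving_affine_def by blast
  obtain B c where G: "det B > 0" "G = (\<lambda>x. B *v x + c)"
    using assms(2) unfolding orientation_preserving_affine_def by blast
  have "F \<circ> G = (\<lambda>x. (A ** B) *v x + (A *v c + b))"
    by (auto simp: F G matrix_vector_right_distrib matrix_vector_mul_assoc)
  moreover have "det (A ** B) > 0" using F G by (simp add: det_mul)
  ultimately show ?thesis unfolding orientation_preserving_affine_def by blast
qed

lemma affine_combination:
  assumes "orientation_preserving_affine F"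
  shows "F ((1 - u) *\<^sub>R x + u *\<^sub>R y) = (1 - u) *\<^sub>R F x + u *\<^sub>R F y"
proof -
  obtain A b where "F = (\<lambda>x. A *v x + b)"
    using assms unfolding orientation_preserving_affine_def by blast
  then show ?thesis
    by (simp add: matrix_vector_right_distrib matrix_vector_mult_scaleR algebra_simps)
qed

lemma affine_closed_segment:
  assumes "orientation_preserving_affine F"
  shows "F ` closed_segment x y = closed_segment (F x) (F y)"
  unfolding closed_segment_def using affine_combination[OF assms] by (auto simp: image_iff) metis

lemma affine_open_segment:
  assumes "orientation_preserving_affine F"
  shows "F ` open_segment x y = open_segment (F x) (F y)"
  unfolding open_segment_def
  using affine_closed_segment[OF assms] orientation_preserving_affine_bij[OF assms]
  by (simp add: image_set_diff bij_is_inj)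

lemma affine_midpoint:
  assumes "orientation_preserving_affine F"
  shows "F (midpoint x y) = midpoint (F x) (F y)"
  using affine_combination[OF assms, of "1/2" x y] by (simp add: midpoint_def scaleR_add_right)

lemma affine_convex_hull:
  assumes "orientation_preserving_affine F"
  shows "F ` (convex hull S) = convex hull (F ` S)"
proof -
  obtain A b where F: "F = (\<lambda>x. A *v x + b)"
    using assms unfolding orientation_preserving_affine_def by blast
  have "F ` T = (\<lambda>x. b + x) ` ((*v) A ` T)" for T
    by (auto simp: F image_image add.commute)
  then show ?thesis
    by (simp add: convex_hull_linear_image convex_hull_translation)
qed

text \<open>Tangency at the midpoint is an affine notion, and the side of a ray is the sign of a
  determinant, which an affine map multiplies by its own positive determinant.\<close>

lemma outer_billiards_affine_iff:
  assumes "orientation_preserving_affine F"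
  shows "outer_billiards (F ` S) (F x) (F y) \<longleftrightarrow> outer_billiards S x y"
proof -
  obtain A b where F: "det A > 0" "F = (\<lambda>x. A *v x + b)"
    using assms unfolding orientation_preserving_affine_def by blast
  have inj: "inj F" using assms orientation_preserving_affine_bij bij_is_inj by blast
  have "det (vector [F y - F x, F z - F x] :: real^2^2) = det A * det (vector [y - x, z - x] :: real^2^2)" for z
    by (simp add: F(2) det_vector_2 det_2 matrix_vector_mult_def sum_2 algebra_simps)
  then have ray: "weakly_right_of_ray (F x) (F y) (F z) \<longleftrightarrow> weakly_right_of_ray x y z" for z
    unfolding weakly_right_of_ray_def using F(1) by (simp add: mult_le_0_iff)
  have "{F (midpoint x y)} = F ` {midpoint x y}" by simp
  then have "closed_segment (F x) (F y) \<inter> F ` S = {midpoint (F x) (F y)} \<longleftrightarrow>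
      F ` (closed_segment x y \<inter> S) = F ` {midpoint x y}"
    by (simp add: affine_closed_segment[OF assms, symmetric] affine_midpoint[OF assms, symmetric]
        image_Int[OF inj])
  also have "\<dots> \<longleftrightarrow> closed_segment x y \<inter> S = {midpoint x y}"
    by (rule inj_image_eq_iff[OF inj])
  finally show ?thesis
    unfolding outer_billiards_def using ray by (auto simp: inj_image_mem_iff[OF inj])
qed

lemma unbounded_orbit_affine_preimage:
  assumes F: "orientation_preserving_affine F"
    and rel: "\<And>x y. R' (F x) (F y) \<Longrightarrow> R x y"
    and orbit: "unbounded_orbit R' q"
  shows "unbounded_orbit R (inv F q)"
proof -
  obtain X where X: "X 0 = q" "\<And>n. R' (X n) (X (Suc n))" "\<not> bounded (range X)"
    using orbit unfolding unbounded_orbit_def by blast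
  have FG: "F (inv F x) = x" for x
    using F orientation_preserving_affine_bij by (metis bij_inv_eq_iff)
  obtain A b where Feq: "F = (\<lambda>x. A *v x + b)"
    using F unfolding orientation_preserving_affine_def by blast
  have "\<not> bounded (range (\<lambda>n. inv F (X n)))"
  proof
    assume "bounded (range (\<lambda>n. inv F (X n)))"
    then have "bounded ((\<lambda>x. b + x) ` ((*v) A ` range (\<lambda>n. inv F (X n))))"
      by (intro bounded_translation bounded_linear_image) simp_all
    also have "(\<lambda>x. b + x) ` ((*v) A ` range (\<lambda>n. inv F (X n))) = range (\<lambda>n. F (inv F (X n)))"
      by (auto simp: Feq image_image add.commute)
    finally show False using X(3) by (simp add: FG)
  qed
  then show ?thesis
    unfolding unbounded_orbit_def using X rel FG
    by (intro exI[of _ "\<lambda>n. inv F (X n)"]) auto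
qed

section \<open>The normalizing affine map\<close>

text \<open>Each vertex lies strictly on one side of a coordinate axis and the other three lie weakly on the
  other side, so it is not in their convex hull.\<close>

lemma extreme_points_normalized_kite:
  "{x. x extreme_point_of normalized_kite} = {pt 0 1, pt (-1) 0, pt 0 (-1), pt tail_length 0}"
proof
  show "{x. x extreme_point_of normalized_kite} \<subseteq> {pt 0 1, pt (-1) 0, pt 0 (-1), pt tail_length 0}"
    unfolding normalized_kite_eq by (rule extreme_points_of_convex_hull)
  have half: "v \<notin> convex hull T" if "\<And>u. u \<in> T \<Longrightarrow> n \<bullet> u \<le> 0" "n \<bullet> v > 0" for n v :: "real^2" and T
  proof -
    have "convex hull T \<subseteq> {u. n \<bullet> u \<le> 0}"
      by (rule hull_minimal) (use that(1) in \<open>auto simp: convex_halfspace_le\<close>)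
    then show ?thesis using that(2) by auto
  qed
  have "pt 0 1 extreme_point_of normalized_kite"
    unfolding normalized_kite_eq
    by (rule extreme_point_of_convex_hull_insert, simp, rule half[of _ "pt 0 1"])
      (auto simp: inner_vec_def sum_2)
  moreover have "pt (-1) 0 extreme_point_of normalized_kite"
    unfolding normalized_kite_eq insert_commute[of "pt 0 1" "pt (-1) 0"]
    by (rule extreme_point_of_convex_hull_insert, simp, rule half[of _ "pt (-1) 0"])
      (use tail_length_bounds in \<open>auto simp: inner_vec_def sum_2\<close>)
  moreover have "pt 0 (-1) extreme_point_of normalized_kite"
    unfolding normalized_kite_eq insert_commute[of "pt (-1) 0" "pt 0 (-1)"] insert_commute[of "pt 0 1" "pt 0 (-1)"]
    by (rule extreme_point_of_convex_hull_insert, simp, rule half[of _ "pt 0 (-1)"])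
      (auto simp: inner_vec_def sum_2)
  moreover have "pt tail_length 0 extreme_point_of normalized_kite"
  proof -
    have "{pt 0 1, pt (-1) 0, pt 0 (-1), pt tail_length 0} =
        insert (pt tail_length 0) {pt 0 1, pt (-1) 0, pt 0 (-1)}" by blast
    then show ?thesis unfolding normalized_kite_eq
      by (simp only:) (rule extreme_point_of_convex_hull_insert, simp, rule half[of _ "pt 1 0"],
        use tail_length_bounds in \<open>auto simp: inner_vec_def sum_2\<close>)
  qed
  ultimately show "{pt 0 1, pt (-1) 0, pt 0 (-1), pt tail_length 0} \<subseteq> {x. x extreme_point_of normalized_kite}"
    by blast
qed

lemma affine_extreme_point:
  assumes "orientation_preserving_affine F" "x extreme_point_of S"
  shows "F x extreme_point_of F ` S"
proof -
  have inj: "inj F" using assms(1) orientation_preserving_affine_bij bij_is_inj by blast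
  show ?thesis using assms(2)
    unfolding extreme_point_of_def
    by (auto simp: affine_open_segment[OF assms(1), symmetric] inj_image_mem_iff[OF inj])
qed

text \<open>The affine map \<open>(x, y) \<mapsto> (p x + q y + c, r x + s y + d)\<close> is determined by
  the images of three vertices, and preserves the relation \<open>(N + S) / 2 = (t W + E) / (1 +
  t)\<close> that expresses how the diagonals cross. The image of \<open>E\<close> is therefore
  determined as well. The choices of vertices for the images that satisfy the relation are the
  identity, the exchange of \<open>N\<close> and \<open>S\<close>, which reverses orientation,
  and degenerate ones.\<close>

lemma kite_vertex_permutation:
  fixes t :: real
  assumes t: "t * t = 1 - 4 * t" "236/1000 < t" "t < 2362/10000"
    and N: "(q + c, s + d) \<in> {(0, 1), (-1, 0), (0, -1), (t, 0)}"
    and W: "(c - p, d - r) \<in> {(0, 1), (-1, 0), (0, -1), (t, 0)}"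
    and S: "(c - q, d - s) \<in> {(0, 1), (-1, 0), (0, -1), (t, 0)}"
    and E: "(t * p + c, t * r + d) \<in> {(0, 1), (-1, 0), (0, -1), (t, 0)}"
    and det: "p * s - q * r > 0"
  shows "p = 1 \<and> q = 0 \<and> r = 0 \<and> s = 1 \<and> c = 0 \<and> d = 0"
proof -
  obtain n1 n2 where n: "q + c = n1" "s + d = n2" by blast
  obtain w1 w2 where w: "c - p = w1" "d - r = w2" by blast
  obtain s1 s2 where s: "c - q = s1" "d - s = s2" by blast
  have c: "c = (n1 + s1) / 2" "q = (n1 - s1) / 2" "d = (n2 + s2) / 2" "s = (n2 - s2) / 2"
    "p = c - w1" "r = d - w2" using n w s by auto
  obtain e1 e2 where e: "t * p + c = e1" "t * r + d = e2" by blast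
  have nv: "n1 = 0 \<and> n2 = 1 \<or> n1 = -1 \<and> n2 = 0 \<or> n1 = 0 \<and> n2 = -1 \<or> n1 = t \<and> n2 = 0"
    and wv: "w1 = 0 \<and> w2 = 1 \<or> w1 = -1 \<and> w2 = 0 \<or> w1 = 0 \<and> w2 = -1 \<or> w1 = t \<and> w2 = 0"
    and sv: "s1 = 0 \<and> s2 = 1 \<or> s1 = -1 \<and> s2 = 0 \<or> s1 = 0 \<and> s2 = -1 \<or> s1 = t \<and> s2 = 0"
    and ev: "e1 = 0 \<and> e2 = 1 \<or> e1 = -1 \<and> e2 = 0 \<or> e1 = 0 \<and> e2 = -1 \<or> e1 = t \<and> e2 = 0"
    using N W S E unfolding n w s e by auto
  have eq: "n1 + s1 + t * n1 + t * s1 = 2 * (t * w1) + 2 * e1"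
    "n2 + s2 + t * n2 + t * s2 = 2 * (t * w2) + 2 * e2"
    unfolding e[symmetric] c by (simp_all add: field_simps)
  have det': "((n1 + s1) / 2 - w1) * (n2 - s2) - (n1 - s1) * ((n2 + s2) / 2 - w2) > 0"
  proof -
    have "((n1 + s1) / 2 - w1) * (n2 - s2) - (n1 - s1) * ((n2 + s2) / 2 - w2) = 2 * (p * s - q * r)"
      unfolding c by (simp add: field_simps)
    then show ?thesis using det by simp
  qed
  have "n1 = 0 \<and> n2 = 1 \<and> s1 = 0 \<and> s2 = -1 \<and> w1 = -1 \<and> w2 = 0"
    using nv sv wv ev
    by (elim disjE conjE; (insert eq det' t; simp add: algebra_simps; fail)?; (insert eq det' t; simp; linarith)?)
  then show ?thesis using c by simp
qed

lemma orientation_preserving_affine_pt: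
  assumes "orientation_preserving_affine F"
  obtains p q r s c d where "p * s - q * r > 0"
    "\<And>x y. F (pt x y) = pt (p * x + q * y + c) (r * x + s * y + d)"
proof -
  obtain A b where F: "det A > 0" "F = (\<lambda>x. A *v x + b)"
    using assms unfolding orientation_preserving_affine_def by blast
  have eq: "F (pt x y) = pt (A$1$1 * x + A$1$2 * y + b$1) (A$2$1 * x + A$2$2 * y + b$2)" for x y
    by (simp add: F(2) vec_eq_iff forall_2 matrix_vector_mult_def sum_2)
  have "A$1$1 * A$2$2 - A$1$2 * A$2$1 > 0" using F(1) by (simp add: det_2)
  then show thesis using eq by (rule that)
qed

text \<open>An affine symmetry permutes the extreme points, that is, the vertices.\<close>

lemma kite_affine_symmetry_trivial:
  assumes "orientation_preserving_affine G" "G ` normalized_kite = normalized_kite"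
  shows "G = id"
proof -
  obtain p q r s c d where det: "p * s - q * r > 0"
    and G: "\<And>x y. G (pt x y) = pt (p * x + q * y + c) (r * x + s * y + d)"
    by (rule orientation_preserving_affine_pt[OF assms(1)]) (rule that)
  let ?V = "{pt 0 1, pt (-1) 0, pt 0 (-1), pt tail_length 0}"
  have vertex: "G v \<in> ?V" if "v \<in> ?V" for v
    using affine_extreme_point[OF assms(1), of v normalized_kite] that
    unfolding assms(2) extreme_points_normalized_kite[symmetric] by blast
  have pt_in: "(x, y) \<in> {(0, 1), (-1, 0), (0, -1), (tail_length, 0)}" if "pt x y \<in> ?V" for x y
    using that by (auto simp: vec_eq_iff forall_2)
  have "p = 1 \<and> q = 0 \<and> r = 0 \<and> s = 1 \<and> c = 0 \<and> d = 0"
  proof (rule kite_vertex_permutation[OF tail_length_square tail_length_bounds _ _ _ _ det])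
    show "(q + c, s + d) \<in> {(0, 1), (-1, 0), (0, -1), (tail_length, 0)}"
      by (rule pt_in) (use vertex[of "pt 0 1"] in \<open>simp add: G\<close>)
    show "(c - p, d - r) \<in> {(0, 1), (-1, 0), (0, -1), (tail_length, 0)}"
      by (rule pt_in) (use vertex[of "pt (-1) 0"] in \<open>simp add: G\<close>)
    show "(c - q, d - s) \<in> {(0, 1), (-1, 0), (0, -1), (tail_length, 0)}"
      by (rule pt_in) (use vertex[of "pt 0 (-1)"] in \<open>simp add: G\<close>)
    show "(tail_length * p + c, tail_length * r + d) \<in> {(0, 1), (-1, 0), (0, -1), (tail_length, 0)}"
      by (rule pt_in) (use vertex[of "pt tail_length 0"] in \<open>simp add: G mult.commute\<close>)
  qed
  then have "G (pt x y) = pt x y" for x y by (simp add: G)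
  then show ?thesis by (metis pt_eta eq_id_iff)
qed

lemma normalization_unique:
  assumes F: "orientation_preserving_affine F" "F ` K = normalized_kite"
    and G: "orientation_preserving_affine G" "G ` K = normalized_kite"
  shows "F = G"
proof -
  have bij: "bij F" using F orientation_preserving_affine_bij by blast
  then have "inv F ` normalized_kite = K" using F(2) by (metis bij_def image_inv_f_f)
  then have "(G \<circ> inv F) ` normalized_kite = normalized_kite"
    using G(2) by (simp only: image_comp[symmetric])
  moreover have "orientation_preserving_affine (G \<circ> inv F)"
    using F G orientation_preserving_affine_comp orientation_preserving_affine_inv by blast
  ultimately have "G \<circ> inv F = id" using kite_affine_symmetry_trivial by blast
  then have "G \<circ> inv F \<circ> F = F" by simp
  then show ?thesis using bij by (simp add: comp_assoc bij_is_inj)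
qed

text \<open>The angle \<open>\<alpha> = \<pi>/5\<close> satisfies \<open>cos 3\<alpha> = - cos
  2\<alpha>\<close>, a cubic equation for \<open>c = cos \<alpha>\<close> with the spurious root
  \<open>-1\<close>. What remains is the equation of the golden ratio for \<open>2 c\<close>.\<close>

lemma cos_fifths: "cos (2 * pi / 5) = (golden_ratio - 1) / 2" "cos (4 * pi / 5) = - golden_ratio / 2"
proof -
  define c where "c = cos (pi / 5)"
  have c0: "c > 0" unfolding c_def by (rule cos_gt_zero) (auto simp: pi_gt_zero)
  have c2: "cos (2 * pi / 5) = 2 * c\<^sup>2 - 1"
    using cos_double_cos[of "pi / 5"] by (simp add: c_def)
  have "cos (3 * pi / 5) = 4 * c ^ 3 - 3 * c"
    using cos_treble_cos[of "pi / 5"] by (simp add: c_def)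
  moreover have "cos (3 * pi / 5) = cos (pi - 2 * pi / 5)" by (rule arg_cong[of _ _ cos]) simp
  then have "cos (3 * pi / 5) = - cos (2 * pi / 5)" by (simp only: cos_pi_minus)
  ultimately have "(c + 1) * (4 * c\<^sup>2 - 2 * c - 1) = 0"
    unfolding c2 by (simp add: power2_eq_square power3_eq_cube algebra_simps)
  then have q: "4 * c\<^sup>2 = 2 * c + 1" using c0 by simp
  then have "(2 * c - golden_ratio) * (2 * c - 1 + golden_ratio) = 0"
    using golden_ratio_square unfolding power2_eq_square by algebra
  moreover have "2 * c - 1 + golden_ratio > 0" using c0 golden_ratio_bounds by simp
  ultimately have c: "c = golden_ratio / 2" by simp
  show "cos (2 * pi / 5) = (golden_ratio - 1) / 2" unfolding c2 using q[unfolded c] by (simp add: c)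
  have "cos (4 * pi / 5) = cos (pi - pi / 5)" by (rule arg_cong[of _ _ cos]) simp
  also have "\<dots> = - c" by (simp only: cos_pi_minus c_def)
  finally show "cos (4 * pi / 5) = - golden_ratio / 2" using c by simp
qed

lemma cos_angle:
  "cos (angle a b c) = ((a - b) \<bullet> (c - b)) / (norm (a - b) * norm (c - b))"
proof (cases "norm (a - b) * norm (c - b) = 0")
  case False
  then have "\<bar>((a - b) \<bullet> (c - b)) / (norm (a - b) * norm (c - b))\<bar> \<le> 1"
    using Cauchy_Schwarz_ineq2[of "a - b" "c - b"] by (simp add: abs_divide divide_le_eq_1)
  then show ?thesis unfolding angle_def by (simp add: cos_arccos_abs)
qed (auto simp: angle_def)

text \<open>The base has the midpoint \<open>(m1, m2)\<close> and the half-length vector \<open>(e1,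
  e2)\<close>, and the height is \<open>p\<close> times the half-length. So \<open>p\<close> is,
  up to sign, the cotangent of half the apex angle.\<close>

lemma isosceles_apex_angle:
  fixes p e1 e2 :: real
  assumes "(e1, e2) \<noteq> (0, 0)"
    and "a = pt (m1 - p * e2) (m2 + p * e1)"
    and "b = pt (m1 - e1) (m2 - e2)" "d = pt (m1 + e1) (m2 + e2)"
  shows "cos (angle b a d) = (p\<^sup>2 - 1) / (p\<^sup>2 + 1)"
proof -
  let ?h = "e1\<^sup>2 + e2\<^sup>2"
  have h: "?h > 0" using assms(1) by (auto simp: sum_power2_gt_zero_iff)
  have n: "norm (b - a) = sqrt (?h * (p\<^sup>2 + 1))" "norm (d - a) = sqrt (?h * (p\<^sup>2 + 1))"
    unfolding assms norm_vec_def L2_set_def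
    by (simp_all add: sum_2 power2_eq_square algebra_simps)
  have "(b - a) \<bullet> (d - a) = ?h * (p\<^sup>2 - 1)"
    unfolding assms by (simp add: inner_vec_def sum_2 power2_eq_square algebra_simps)
  moreover have "norm (b - a) * norm (d - a) = ?h * (p\<^sup>2 + 1)"
    unfolding n using h by simp
  ultimately have "cos (angle b a d) = ?h * (p\<^sup>2 - 1) / (?h * (p\<^sup>2 + 1))"
    by (simp only: cos_angle)
  then show ?thesis using mult_divide_mult_cancel_left[of ?h "p\<^sup>2 - 1" "p\<^sup>2 + 1"] assms(1) by auto
qed

text \<open>The equalities of distances put \<open>a\<close> and \<open>c\<close> on the perpendicular
  bisector of the diagonal \<open>bd\<close>, at signed heights \<open>p\<close> and
  \<open>q\<close> measured in half-diagonals. The angles at \<open>a\<close> and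
  \<open>c\<close> determine \<open>p\<^sup>2\<close> and \<open>q\<^sup>2\<close>, and their
  quotient is the square of the tail length. Since the diagonals cross, the heights have
  opposite signs. The axes of the kite can then be mapped to the coordinate axes; the sign
  \<open>\<sigma>\<close> decides which of \<open>b\<close> and \<open>d\<close> becomes the
  north vertex, so that the orientation is preserved.\<close>

lemma penrose_kite_normalization_exists:
  assumes "is_penrose_kite K"
  obtains F where "orientation_preserving_affine F" "F ` K = normalized_kite"
proof -
  obtain a b c d where K: "K = convex hull {a, b, c, d}" and quad: "convex_quadrilateral a b c d"
    and dist: "dist a b = dist a d" "dist c b = dist c d"
    and ang: "angle d a b = 2 * pi / 5" "angle b c d = 4 * pi / 5"
    using assms unfolding is_penrose_kite_def by blast
  define m1 m2 e1 e2 where "m1 = (b$1 + d$1) / 2" and "m2 = (b$2 + d$2) / 2"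
    and "e1 = (d$1 - b$1) / 2" and "e2 = (d$2 - b$2) / 2"
  have b: "b = pt (m1 - e1) (m2 - e2)" and d: "d = pt (m1 + e1) (m2 + e2)"
    by (simp_all add: vec_eq_iff forall_2 m1_def m2_def e1_def e2_def field_simps)
  have e: "(e1, e2) \<noteq> (0, 0)"
  proof
    assume "(e1, e2) = (0, 0)"
    then have "b = d" using b d by simp
    then have "collinear {d, a, b}" by (simp add: insert_commute)
    then show False using quad unfolding convex_quadrilateral_def by blast
  qed
  define h where "h = e1\<^sup>2 + e2\<^sup>2"
  have h: "h > 0" using e by (auto simp: h_def sum_power2_gt_zero_iff)
  have on_axis: "\<exists>p. v = pt (m1 - p * e2) (m2 + p * e1)" if "dist v b = dist v d" for v
  proof -
    have "(dist v b)\<^sup>2 = (dist v d)\<^sup>2" using that by simp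
    moreover have "(dist v b)\<^sup>2 - (dist v d)\<^sup>2 = 4 * ((v$1 - m1) * e1 + (v$2 - m2) * e2)"
      unfolding dist_norm power2_norm_eq_inner b d
      by (simp add: inner_vec_def sum_2 algebra_simps)
    ultimately have "(v$1 - m1) * e1 + (v$2 - m2) * e2 = 0" by simp
    then have o: "(v$1 - m1) * e1 = - ((v$2 - m2) * e2)" by simp
    define p where "p = ((v$2 - m2) * e1 - (v$1 - m1) * e2) / h"
    have ph: "p * h = (v$2 - m2) * e1 - (v$1 - m1) * e2" using h by (simp add: p_def)
    have "h * (v$1 - m1) = e1 * ((v$1 - m1) * e1) + e2 * e2 * (v$1 - m1)"
      by (simp add: h_def power2_eq_square algebra_simps)
    also have "\<dots> = - (p * h) * e2" unfolding o ph by (simp add: algebra_simps)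
    also have "\<dots> = h * (- p * e2)" by simp
    finally have 1: "v$1 - m1 = - p * e2" using h by (simp only: mult_cancel_left) simp
    have "h * (v$2 - m2) = e2 * ((v$2 - m2) * e2) + e1 * e1 * (v$2 - m2)"
      by (simp add: h_def power2_eq_square algebra_simps)
    also have "(v$2 - m2) * e2 = - ((v$1 - m1) * e1)" using o by simp
    also have "e2 * - ((v$1 - m1) * e1) + e1 * e1 * (v$2 - m2) = (p * h) * e1"
      unfolding ph by (simp add: algebra_simps)
    also have "\<dots> = h * (p * e1)" by simp
    finally have 2: "v$2 - m2 = p * e1" using h by (simp only: mult_cancel_left) simp
    show ?thesis by (rule exI[of _ p]) (use 1 2 in \<open>simp add: vec_eq_iff forall_2 algebra_simps\<close>)
  qed
  obtain p where a: "a = pt (m1 - p * e2) (m2 + p * e1)" using on_axis dist(1) by blast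
  obtain q where c: "c = pt (m1 - q * e2) (m2 + q * e1)" using on_axis dist(2) by blast
  have "(p\<^sup>2 - 1) / (p\<^sup>2 + 1) = (golden_ratio - 1) / 2"
  proof -
    have "angle d a b = angle b a d" by (simp add: angle_def inner_commute mult.commute)
    then show ?thesis
      using isosceles_apex_angle[OF e a b d] ang(1) cos_fifths(1) by simp
  qed
  moreover have p1: "p\<^sup>2 + 1 > 0" "q\<^sup>2 + 1 > 0" by (simp_all add: add_nonneg_pos)
  ultimately have "p\<^sup>2 - 1 = (golden_ratio - 1) / 2 * (p\<^sup>2 + 1)"
    by (subst (asm) nonzero_divide_eq_eq) auto
  then have p: "2 * (p\<^sup>2 - 1) = (golden_ratio - 1) * (p\<^sup>2 + 1)" by (simp only: )
  have "(q\<^sup>2 - 1) / (q\<^sup>2 + 1) = - golden_ratio / 2"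
    using isosceles_apex_angle[OF e c b d] ang(2) cos_fifths(2) by simp
  with p1 have "q\<^sup>2 - 1 = - golden_ratio / 2 * (q\<^sup>2 + 1)"
    by (subst (asm) nonzero_divide_eq_eq) auto
  then have q: "2 * (q\<^sup>2 - 1) = - golden_ratio * (q\<^sup>2 + 1)" by (simp only: )
  have "p * p * (3 - golden_ratio) - (golden_ratio + 1) = 2 * (p\<^sup>2 - 1) - (golden_ratio - 1) * (p\<^sup>2 + 1)"
    "q * q * (golden_ratio + 2) - (2 - golden_ratio) = 2 * (q\<^sup>2 - 1) - (- golden_ratio) * (q\<^sup>2 + 1)"
    by (simp_all add: power2_eq_square algebra_simps)
  then have pp: "p * p * (3 - golden_ratio) = golden_ratio + 1" and qq: "q * q * (golden_ratio + 2) = 2 - golden_ratio"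
    unfolding p q by simp_all
  have "(q - tail_length * p) * (q + tail_length * p) * (golden_ratio + 2) * (3 - golden_ratio) =
      q * q * (golden_ratio + 2) * (3 - golden_ratio) -
      (tail_length * tail_length) * (p * p * (3 - golden_ratio)) * (golden_ratio + 2)"
    by (simp add: algebra_simps)
  also have "\<dots> = (2 - golden_ratio) * (3 - golden_ratio) -
      (tail_length * tail_length) * (golden_ratio + 1) * (golden_ratio + 2)"
    unfolding pp qq ..
  also have "\<dots> = 0" unfolding tail_length_def using golden_ratio_square by algebra
  finally have "(q - tail_length * p) * (q + tail_length * p) * (golden_ratio + 2) * (3 - golden_ratio) = 0" .
  then have "q = tail_length * p \<or> q = - tail_length * p" using golden_ratio_bounds by auto
  have p0: "p \<noteq> 0" using p golden_ratio_bounds by auto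
  have opposite: "q = - tail_length * p"
  proof -
    obtain z where z: "z \<in> open_segment a c" "z \<in> open_segment b d"
      using quad unfolding convex_quadrilateral_def by blast
    obtain u where u: "0 < u" "u < 1" "z = (1 - u) *\<^sub>R a + u *\<^sub>R c" using z(1) unfolding in_segment by blast
    obtain v where v: "z = (1 - v) *\<^sub>R b + v *\<^sub>R d" using z(2) unfolding in_segment by blast
    define r where "r = (1 - u) * p + u * q"
    have "m1 - r * e2 = z $ 1" "m2 + r * e1 = z $ 2"
      unfolding u(3) a c r_def by (simp_all add: algebra_simps)
    moreover have "m1 + (2 * v - 1) * e1 = z $ 1" "m2 + (2 * v - 1) * e2 = z $ 2"
      unfolding v b d by (simp_all add: algebra_simps)
    ultimately have z1: "r * e2 = - ((2 * v - 1) * e1)" "r * e1 = (2 * v - 1) * e2" by linarith+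
    have "r * h = e1 * (r * e1) + e2 * (r * e2)"
      by (simp add: h_def power2_eq_square algebra_simps)
    also have "\<dots> = 0" unfolding z1 by (simp add: algebra_simps)
    finally have "((1 - u) * p + u * q) * h = 0" unfolding r_def .
    then have "(1 - u) * p + u * q = 0" using h by simp
    moreover have "(1 - u) * p + u * (tail_length * p) \<noteq> 0"
    proof -
      have "(1 - u) + u * tail_length > 0" using u tail_length_bounds by (simp add: add_pos_pos)
      then have "p * ((1 - u) + u * tail_length) \<noteq> 0" using p0 by simp
      then show ?thesis by (simp add: algebra_simps)
    qed
    ultimately show ?thesis using \<open>q = tail_length * p \<or> q = - tail_length * p\<close> by auto
  qed
  define \<sigma> where "\<sigma> = sgn p"
  define A :: "real^2^2" where "A = vector [vector [e2 / (p * h), - e1 / (p * h)], vector [\<sigma> * e1 / h, \<sigma> * e2 / h]]"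
  define F where "F = (\<lambda>x. A *v x + - (A *v pt m1 m2))"
  have F_pt: "F (pt (m1 + x) (m2 + y)) = pt ((e2 * x - e1 * y) / (p * h)) (\<sigma> * (e1 * x + e2 * y) / h)" for x y
  proof -
    have "F (pt (m1 + x) (m2 + y)) = A *v (pt (m1 + x) (m2 + y) - pt m1 m2)"
      by (simp add: F_def matrix_vector_mult_diff_distrib)
    also have "pt (m1 + x) (m2 + y) - pt m1 m2 = pt x y" by (simp add: vec_eq_iff forall_2)
    finally show ?thesis
      by (simp add: A_def vec_eq_iff forall_2 matrix_vector_mult_def sum_2
          diff_divide_distrib add_divide_distrib distrib_left mult.assoc)
  qed
  have "det A = \<sigma> / (p * h)"
  proof -
    have "det A = \<sigma> * (e2 * e2 + e1 * e1) / (p * h * h)"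
      by (simp add: A_def det_2 add_divide_distrib distrib_left mult_ac)
    moreover have "e2 * e2 + e1 * e1 = h" by (simp add: h_def power2_eq_square)
    ultimately show ?thesis using h by simp
  qed
  also have "\<dots> > 0" using h p0 by (auto simp: \<sigma>_def sgn_if zero_less_divide_iff mult_less_0_iff)
  finally have opa: "orientation_preserving_affine F"
    unfolding orientation_preserving_affine_def F_def by blast
  have sq: "e1 * e1 + e2 * e2 = h" by (simp add: h_def power2_eq_square)
  have Fa: "F a = pt (-1) 0"
  proof -
    have 1: "F a = pt ((e2 * (- p * e2) - e1 * (p * e1)) / (p * h)) (\<sigma> * (e1 * (- p * e2) + e2 * (p * e1)) / h)"
      using F_pt[of "- p * e2" "p * e1"] by (simp add: a)
    have 2: "e2 * (- p * e2) - e1 * (p * e1) = - (p * h)" unfolding sq[symmetric] by algebra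
    have 3: "e1 * (- p * e2) + e2 * (p * e1) = 0" by algebra
    show ?thesis unfolding 1 2 3 using h p0 by simp
  qed
  have Fc: "F c = pt tail_length 0"
  proof -
    have 1: "F c = pt ((e2 * (- q * e2) - e1 * (q * e1)) / (p * h)) (\<sigma> * (e1 * (- q * e2) + e2 * (q * e1)) / h)"
      using F_pt[of "- q * e2" "q * e1"] by (simp add: c)
    have 2: "e2 * (- q * e2) - e1 * (q * e1) = tail_length * (p * h)"
      unfolding sq[symmetric] opposite by algebra
    have 3: "e1 * (- q * e2) + e2 * (q * e1) = 0" by algebra
    show ?thesis unfolding 1 2 3 using h p0 by simp
  qed
  have Fb: "F b = pt 0 (- \<sigma>)"
  proof -
    have 1: "F b = pt ((e2 * (- e1) - e1 * (- e2)) / (p * h)) (\<sigma> * (e1 * (- e1) + e2 * (- e2)) / h)"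
      using F_pt[of "- e1" "- e2"] by (simp add: b)
    have 2: "e1 * (- e1) + e2 * (- e2) = - h" unfolding sq[symmetric] by algebra
    have 3: "e2 * (- e1) - e1 * (- e2) = 0" by algebra
    show ?thesis unfolding 1 2 3 using h by simp
  qed
  have Fd: "F d = pt 0 \<sigma>"
  proof -
    have 1: "F d = pt ((e2 * e1 - e1 * e2) / (p * h)) (\<sigma> * (e1 * e1 + e2 * e2) / h)"
      using F_pt[of "e1" "e2"] by (simp add: d)
    have 3: "e2 * e1 - e1 * e2 = 0" by algebra
    show ?thesis unfolding 1 sq 3 using h by simp
  qed
  have "F ` K = convex hull (F ` {a, b, c, d})" unfolding K by (rule affine_convex_hull[OF opa])
  also have "F ` {a, b, c, d} = {pt 0 1, pt (-1) 0, pt 0 (-1), pt tail_length 0}"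
    using p0 by (auto simp: Fa Fb Fc Fd \<sigma>_def sgn_if)
  finally have "F ` K = normalized_kite" by (simp add: normalized_kite_eq)
  with opa that show thesis by blast
qed

section \<open>Reflections in the vertices of the kite\<close>

abbreviation billiard :: "real^2 \<Rightarrow> real^2 \<Rightarrow> bool" where
  "billiard \<equiv> outer_billiards normalized_kite"

abbreviation reaches :: "real^2 \<Rightarrow> real^2 \<Rightarrow> bool" where
  "reaches \<equiv> billiard\<^sup>*\<^sup>*"

text \<open>The determinant is an affine function of the point \<open>z\<close> that vanishes on the ray
  from \<open>x\<close> through \<open>v\<close>. If it is negative at all other vertices then
  it is negative on the whole polygon except at \<open>v\<close>, so the ray meets the polygon
  in \<open>v\<close> only.\<close>

lemma outer_billiards_polygon_vertex:
  fixes V :: "(real^2) set"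
  assumes v: "v \<in> V" and w: "w \<in> V" "w \<noteq> v"
    and right: "\<And>u. u \<in> V \<Longrightarrow> u \<noteq> v \<Longrightarrow> det (vector [v - x, u - x] :: real^2^2) < 0"
  shows "outer_billiards (convex hull V) x (2 *\<^sub>R v - x)"
proof -
  define L where "L z = det (vector [v - x, z - x] :: real^2^2)" for z
  have L_combination: "L ((1 - t) *\<^sub>R a + t *\<^sub>R b) = (1 - t) * L a + t * L b" for t a b
    by (simp add: L_def det_vector_2 algebra_simps)
  have Lv: "L v = 0" and Lx: "L x = 0" by (simp_all add: L_def det_vector_2)
  have "convex {z. z = v \<or> L z < 0}"
    unfolding convex_alt
  proof (intro ballI allI impI)
    fix a b t assume ab: "a \<in> {z. z = v \<or> L z < 0}" "b \<in> {z. z = v \<or> L z < 0}" and t: "0 \<le> t \<and> t \<le> (1::real)"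
    have La: "L a \<le> 0" and Lb: "L b \<le> 0" using ab Lv by auto
    have le: "(1 - t) * L a \<le> 0" "t * L b \<le> 0" using La Lb t by (simp_all add: mult_nonneg_nonpos)
    consider "a = v" "b = v" | "t = 0" | "t = 1" | "L a < 0" "t < 1" "0 < t" | "L b < 0" "t < 1" "0 < t"
      using ab t by force
    then show "(1 - t) *\<^sub>R a + t *\<^sub>R b \<in> {z. z = v \<or> L z < 0}"
    proof cases
      case 1 then show ?thesis by (simp flip: scaleR_left_distrib)
    next
      case 4
      then have "(1 - t) * L a < 0" by (simp add: mult_pos_neg)
      then show ?thesis using le L_combination[of t a b] by simp
    next
      case 5
      then have "t * L b < 0" by (simp add: mult_pos_neg)
      then show ?thesis using le L_combination[of t a b] by simp
    qed (use ab in auto)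
  qed
  then have "convex hull V \<subseteq> {z. z = v \<or> L z < 0}"
    by (intro hull_minimal) (use right in \<open>auto simp: L_def\<close>)
  then have hull: "z = v \<or> L z < 0" if "z \<in> convex hull V" for z using that by blast
  have vV: "v \<in> convex hull V" using v by (rule hull_inc)
  have "x \<noteq> v" using right[OF w] by (auto simp: det_vector_2)
  then have "x \<notin> convex hull V" using hull[of x] Lx by auto
  moreover have mid: "midpoint x (2 *\<^sub>R v - x) = v"
    by (simp add: midpoint_def)
  have "L z = 0" if z: "z \<in> closed_segment x (2 *\<^sub>R v - x)" for z
  proof -
    obtain t where t: "z = (1 - t) *\<^sub>R x + t *\<^sub>R (2 *\<^sub>R v - x)" using z unfolding in_segment by blast
    show ?thesis unfolding t L_combination by (simp add: L_def det_vector_2 algebra_simps)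
  qed
  then have "closed_segment x (2 *\<^sub>R v - x) \<inter> convex hull V \<subseteq> {v}" using hull by force
  moreover have "v \<in> closed_segment x (2 *\<^sub>R v - x)" by (metis mid midpoint_in_closed_segment)
  moreover have "weakly_right_of_ray x (2 *\<^sub>R v - x) z" if "z \<in> convex hull V" for z
  proof -
    have "det (vector [2 *\<^sub>R v - x - x, z - x] :: real^2^2) = 2 * L z"
      by (simp add: L_def det_vector_2 algebra_simps)
    then show ?thesis unfolding weakly_right_of_ray_def using hull[OF that] Lv by auto
  qed
  ultimately show ?thesis unfolding outer_billiards_def mid using vV by blast
qed

text \<open>The four reflections that follow hold on the open cones at the vertices that are bounded by the
  lines through the adjacent edges.\<close>

lemma reflect_north:
  assumes "x + tail_length * y < tail_length" "x + 1 < y" "x < 0"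
  shows "billiard (pt x y) (pt (- x) (2 - y))"
proof -
  have "2 *\<^sub>R pt 0 1 - pt x y = pt (- x) (2 - y)" by (simp add: vec_eq_iff forall_2)
  moreover have "billiard (pt x y) (2 *\<^sub>R pt 0 1 - pt x y)"
    unfolding normalized_kite_eq
    by (rule outer_billiards_polygon_vertex[where w = "pt 0 (-1)"])
      (use assms in \<open>auto simp: det_vector_2 vec_eq_iff forall_2 algebra_simps\<close>)
  ultimately show ?thesis by simp
qed

lemma reflect_west:
  assumes "y < 0" "- 1 < x - y" "x + y < - 1"
  shows "billiard (pt x y) (pt (- 2 - x) (- y))"
proof -
  have "2 *\<^sub>R pt (-1) 0 - pt x y = pt (- 2 - x) (- y)" by (simp add: vec_eq_iff forall_2)
  moreover have "tail_length * y < 0" using assms(1) tail_length_bounds by (simp add: mult_pos_neg)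
  then have "billiard (pt x y) (2 *\<^sub>R pt (-1) 0 - pt x y)"
    unfolding normalized_kite_eq
    by (intro outer_billiards_polygon_vertex[where w = "pt 0 (-1)"])
      (use assms in \<open>auto simp: det_vector_2 vec_eq_iff forall_2 algebra_simps\<close>)
  ultimately show ?thesis by simp
qed

lemma reflect_south:
  assumes "tail_length + tail_length * y < x" "- 1 < x + y" "0 < x"
  shows "billiard (pt x y) (pt (- x) (- 2 - y))"
proof -
  have "2 *\<^sub>R pt 0 (-1) - pt x y = pt (- x) (- 2 - y)" by (simp add: vec_eq_iff forall_2)
  moreover have "billiard (pt x y) (2 *\<^sub>R pt 0 (-1) - pt x y)"
    unfolding normalized_kite_eq
    by (rule outer_billiards_polygon_vertex[where w = "pt 0 1"])
      (use assms in \<open>auto simp: det_vector_2 vec_eq_iff forall_2 algebra_simps\<close>)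
  ultimately show ?thesis by simp
qed

lemma reflect_east:
  assumes "tail_length < x + tail_length * y" "x < tail_length + tail_length * y" "0 < y"
  shows "billiard (pt x y) (pt (2 * tail_length - x) (- y))"
proof -
  have "2 *\<^sub>R pt tail_length 0 - pt x y = pt (2 * tail_length - x) (- y)"
    by (simp add: vec_eq_iff forall_2)
  moreover have "0 < tail_length * y" using assms(3) tail_length_bounds by simp
  then have "billiard (pt x y) (2 *\<^sub>R pt tail_length 0 - pt x y)"
    unfolding normalized_kite_eq
    by (intro outer_billiards_polygon_vertex[where w = "pt 0 1"])
      (use assms tail_length_bounds in \<open>auto simp: det_vector_2 vec_eq_iff forall_2 algebra_simps\<close>)
  ultimately show ?thesis by simp
qed

lemma reaches2:
  assumes "billiard p q" "billiard q r" "r = s"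
  shows "reaches p s"
  using assms by (meson r_into_rtranclp rtranclp.rtrancl_into_rtrancl)

lemma reaches_iterate:
  assumes "\<And>i. i < k \<Longrightarrow> reaches (P i) (P (Suc i))"
  shows "reaches (P 0) (P k)"
  using assms
proof (induction k)
  case (Suc k)
  then have "reaches (P 0) (P k)" by simp
  moreover have "reaches (P k) (P (Suc k))" using Suc.prems by simp
  ultimately show ?case by (rule rtranclp_trans)
qed simp

text \<open>Linear arithmetic treats products with the tail length as unknowns. These bounds, which use
  \<open>t < 1/4\<close>, are what it has to be told about them.\<close>

lemma tail_length_mult_nonneg:
  assumes "0 \<le> t" shows "0 \<le> tail_length * t" "4 * (tail_length * t) \<le> t"
  using assms tail_length_bounds mult_right_mono[of tail_length "1/4" t] by auto

lemma tail_length_mult_nonpos: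
  assumes "t \<le> 0" shows "tail_length * t \<le> 0" "t \<le> 4 * (tail_length * t)"
  using tail_length_mult_nonneg[of "- t"] assms by auto

section \<open>Half turns around the kite\<close>

text \<open>Starting to the right of the kite, the orbit moves by double reflections: first in the south and
  north vertices, by \<open>(0, 4)\<close>; then in south and west, by \<open>(-2, 2)\<close>;
  in east and west, by \<open>(-2 - 2t, 0)\<close>; in north and west, by \<open>(-2,
  -2)\<close>; and finally in north and south, by \<open>(0, -4)\<close>. The hypotheses
  \<open>c1\<close> to \<open>c4\<close> say that the blocks end in the strips whose first sides
  are the lines through the edges west-north, south-east, north-east and west-south. The value
  of the linear form that defines a strip changes in one step of its block by exactly the width
  of the strip, so that the numbers of steps \<open>k1\<close> to \<open>k4\<close> are
  determined. The proof shows that these numbers are not negative and that every intermediate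
  point lies in the cones required by the two reflections.

  The points with \<open>y = 1\<close> and \<open>0 < x < 2t\<close> are exceptional. They
  reflect in east and then directly in south, without entering the third and the fourth block.
  The total displacement is nevertheless the one given by the formula, with \<open>k3 =
  1\<close> and \<open>k4 = -1\<close>.\<close>

lemma upper_half_turn:
  fixes x x2 x3 x4 :: real and y0 y1 y2 y4 y5 k1 k2 k3 k4 k5 :: int
  assumes x: "0 < x" and y0: "y0 = 1 \<or> y0 = -1"
    and y1: "y1 = y0 + 4 * k1" and c1: "- 1 < x - y1" "x - y1 < 3"
    and x2: "x2 = x - 2 * k2" and y2: "y2 = y1 + 2 * k2"
    and c2: "- tail_length < tail_length * y2 - x2" "tail_length * y2 - x2 < tail_length + 2"
    and x3: "x3 = x2 - (2 + 2 * tail_length) * k3"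
    and c3: "- tail_length - 2 < x3 + tail_length * y2" "x3 + tail_length * y2 < tail_length"
    and x4: "x4 = x3 - 2 * k4" and y4: "y4 = y2 - 2 * k4" and c4: "- 1 < x4 + y4" "x4 + y4 < 3"
    and y5: "y5 = y4 + 4 * k5" "y5 = 1 \<or> y5 = -1"
  shows "reaches (pt x y0) (pt x4 y5) \<and> x4 < 0"
proof -
  let ?t = tail_length
  note tl = tail_length_bounds
  have k1: "0 \<le> k1" using c1 x y0 y1 by auto
  then have y1_ge: "- 1 \<le> y1" using y0 y1 by auto
  have k2: "0 \<le> k2"
  proof (rule ccontr)
    assume "\<not> 0 \<le> k2"
    then have "k2 \<le> - 1" by simp
    then have k: "real_of_int k2 \<le> - 1" by linarith
    have "?t * (x + 1 - y1) \<ge> 0" "?t * (- 1 - k2) \<ge> 0" "4 * (?t * (x + 1)) \<le> x + 1"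
      using c1 k x tl by (auto intro: tail_length_mult_nonneg)
    then show False using c2(1) x k tl unfolding x2 y2 by (simp add: algebra_simps)
  qed
  have y2_odd: "odd y2" unfolding y2 y1 using y0 by auto
  have y2_pos: "1 \<le> y2"
  proof -
    have "- 1 \<le> y2" using y1_ge k2 y2 by simp
    moreover have "y2 \<noteq> - 1"
    proof
      assume "y2 = - 1"
      then have "k2 = 0" using y1_ge k2 y2 by simp
      then show False using c2(1) x \<open>y2 = - 1\<close> by (simp add: x2)
    qed
    ultimately show ?thesis using y2_odd by presburger
  qed
  have k3: "0 \<le> k3"
  proof (rule ccontr)
    assume "\<not> 0 \<le> k3"
    then have "k3 \<le> - 1" by simp
    then have k: "real_of_int k3 \<le> - 1" by linarith
    have "?t * (- 1 - k3) \<ge> 0" "?t * y2 \<ge> 0"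
      using k y2_pos by (auto intro: tail_length_mult_nonneg)
    then show False using c3(2) c2(2) k tl unfolding x3 by (simp add: algebra_simps)
  qed
  have stage1: "reaches (pt x y0) (pt x y1)"
  proof -
    have "reaches (pt x (y0 + 4 * real 0)) (pt x (y0 + 4 * real (nat k1)))"
    proof (rule reaches_iterate)
      fix i assume i: "i < nat k1"
      define Y where "Y = y0 + 4 * real i"
      have "real i + 1 \<le> k1" using i by linarith
      then have Y: "- 1 \<le> Y" "Y \<le> y1 - 4" using y0 y1 by (auto simp: Y_def)
      have t: "4 * (?t * (1 + Y)) \<le> 1 + Y" "0 \<le> ?t * (1 + Y)"
        using Y tail_length_mult_nonneg[of "1 + Y"] by auto
      have "billiard (pt x Y) (pt (- x) (- 2 - Y))"
        by (rule reflect_south) (use t Y c1 x tl in \<open>auto simp: algebra_simps\<close>)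
      moreover have "billiard (pt (- x) (- 2 - Y)) (pt (- (- x)) (2 - (- 2 - Y)))"
        by (rule reflect_north) (use t Y c1 x tl in \<open>auto simp: algebra_simps\<close>)
      ultimately show "reaches (pt x (y0 + 4 * real i)) (pt x (y0 + 4 * real (Suc i)))"
        unfolding Y_def by (rule reaches2) (simp add: algebra_simps)
    qed
    then show ?thesis using k1 y1 by simp
  qed
  have stage2: "reaches (pt x y1) (pt x2 y2)"
  proof -
    have "reaches (pt (x - 2 * real 0) (y1 + 2 * real 0)) (pt (x - 2 * real (nat k2)) (y1 + 2 * real (nat k2)))"
    proof (rule reaches_iterate)
      fix i assume i: "i < nat k2"
      define X Y j where "X = x - 2 * real i" and "Y = y1 + 2 * real i" and "j = real_of_int k2 - real i"
      have j: "1 \<le> j" using i unfolding j_def by linarith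
      have Y: "- 1 \<le> Y" "X - Y < 3" using y1_ge c1 by (auto simp: X_def Y_def)
      have e: "x2 = X - 2 * j" "y2 = Y + 2 * j" by (simp_all add: X_def Y_def j_def x2 y2)
      have t: "?t * (1 + Y) \<ge> 0" "?t * (j - 1) \<ge> 0"
        using Y j by (auto intro: tail_length_mult_nonneg)
      have "?t * y2 = ?t * Y + 2 * (?t * j)" unfolding e by (simp add: algebra_simps)
      then have X: "?t + ?t * Y < X" using c2(2) t j e by (simp add: algebra_simps)
      have "billiard (pt X Y) (pt (- X) (- 2 - Y))"
        by (rule reflect_south) (use X t Y in \<open>auto simp: algebra_simps\<close>)
      moreover have "billiard (pt (- X) (- 2 - Y)) (pt (- 2 - (- X)) (- (- 2 - Y)))"
        by (rule reflect_west) (use X t Y in \<open>auto simp: algebra_simps\<close>)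
      ultimately show "reaches (pt (x - 2 * real i) (y1 + 2 * real i))
          (pt (x - 2 * real (Suc i)) (y1 + 2 * real (Suc i)))"
        unfolding X_def Y_def by (rule reaches2) (simp add: algebra_simps)
    qed
    then show ?thesis using k2 x2 y2 by simp
  qed
  show ?thesis
  proof (cases "y2 = 1 \<and> 0 < x2")
    \<comment> \<open>the exceptional points: the first two blocks are empty\<close>
    case True
    have "k2 = 0"
    proof (rule ccontr)
      assume "k2 \<noteq> 0"
      then have "y1 = - 1" "k2 = 1" using True k2 y1_ge y2 by auto
      then show False using c1 True x2 by simp
    qed
    then have xx: "x2 = x" "y1 = 1" using x2 y2 True by auto
    have x_small: "x < 2 * ?t" using c2 True xx by simp
    have k3: "k3 = 1"
    proof -
      have "k3 \<noteq> 0" using c3(2) True by (auto simp: x3)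
      moreover have "\<not> 2 \<le> k3"
      proof
        assume "2 \<le> k3"
        then have k: "2 \<le> real_of_int k3" by linarith
        then have "0 \<le> ?t * (k3 - 2)" by (intro tail_length_mult_nonneg) simp
        then have "2 * ?t \<le> ?t * k3" by (simp add: algebra_simps)
        moreover have "x3 = x - 2 * k3 - 2 * (?t * k3)" by (simp add: x3 xx algebra_simps)
        moreover have "?t * y2 = ?t" using True by simp
        ultimately show False using c3(1) k x_small tl by linarith
      qed
      ultimately show ?thesis using k3 by simp
    qed
    have k4: "k4 = - 1"
    proof -
      have e: "x4 + y4 = x - 1 - 2 * ?t - 4 * k4" by (simp add: x4 y4 x3 k3 xx True)
      have "real_of_int k4 < 0" using c4(1) e x_small by simp
      moreover have "- 2 < real_of_int k4" using c4(2) e x tl by simp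
      ultimately show ?thesis by linarith
    qed
    have "y5 = 3 + 4 * k5" using y5 True by (simp add: y4 k4)
    then have "y5 = - 1" using y5(2) by presburger
    moreover have "x4 = x - 2 * ?t" by (simp add: x4 x3 xx k3 k4)
    moreover have "billiard (pt x 1) (pt (2 * ?t - x) (- 1))"
      by (rule reflect_east) (use x x_small in auto)
    moreover have "billiard (pt (2 * ?t - x) (- 1)) (pt (- (2 * ?t - x)) (- 2 - (- 1)))"
      by (rule reflect_south) (use x x_small tl in auto)
    ultimately have "reaches (pt x2 y2) (pt x4 y5)" using True xx by (auto intro!: reaches2)
    then show ?thesis using stage1 stage2 \<open>x4 = x - 2 * ?t\<close> x_small by (meson add_less_cancel_right diff_less_0_iff_less rtranclp_trans)
  next
    case False
    have "y2 = 1 \<or> 3 \<le> y2" using y2_pos y2_odd by presburger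
    then have y2_3: "x2 \<le> 0 \<or> 3 \<le> y2" using False by auto
    have ty2: "4 * (?t * y2) \<le> y2" "0 \<le> ?t * y2" "0 \<le> ?t * (y2 - 1)"
      using y2_pos tail_length_mult_nonneg[of "real_of_int y2"] tail_length_mult_nonneg[of "real_of_int y2 - 1"] by auto
    have stage3: "reaches (pt x2 y2) (pt x3 y2)"
    proof -
      have "reaches (pt (x2 - (2 + 2 * ?t) * real 0) y2) (pt (x2 - (2 + 2 * ?t) * real (nat k3)) y2)"
      proof (rule reaches_iterate)
        fix i assume i: "i < nat k3"
        define X j where "X = x2 - (2 + 2 * ?t) * real i" and "j = real_of_int k3 - real i"
        have j: "1 \<le> j" using i unfolding j_def by linarith
        have e: "x3 = X - (2 + 2 * ?t) * j" by (simp add: X_def j_def x3 algebra_simps)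
        have X_le: "X \<le> x2" using tl by (simp add: X_def)
        have "(2 + 2 * ?t) * (j - 1) \<ge> 0" using j tl by simp
        then have X: "?t < X + ?t * y2" using c3(1) unfolding e by (simp add: algebra_simps)
        have "1 + 2 * ?t < X + y2"
        proof (cases "3 \<le> y2")
          case True
          then have "3 \<le> real_of_int y2" by linarith
          then show ?thesis using X ty2 tl by linarith
        next
          case False
          then have "x2 \<le> 0" "y2 = 1" using y2_3 y2_pos \<open>y2 = 1 \<or> 3 \<le> y2\<close> by auto
          then show ?thesis using X X_le by simp
        qed
        have "billiard (pt X y2) (pt (2 * ?t - X) (- real_of_int y2))"
          by (rule reflect_east) (use X c2 X_le y2_pos in auto)
        moreover have "billiard (pt (2 * ?t - X) (- real_of_int y2)) (pt (- 2 - (2 * ?t - X)) (- (- real_of_int y2)))"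
          by (rule reflect_west) (use \<open>1 + 2 * ?t < X + y2\<close> X c2 X_le y2_pos ty2 tl in auto)
        ultimately show "reaches (pt (x2 - (2 + 2 * ?t) * real i) y2) (pt (x2 - (2 + 2 * ?t) * real (Suc i)) y2)"
          unfolding X_def by (rule reaches2) (simp add: algebra_simps)
      qed
      then show ?thesis using k3 x3 by simp
    qed
    have k4: "0 \<le> k4"
    proof (rule ccontr)
      assume "\<not> 0 \<le> k4"
      then have "k4 \<le> - 1" by simp
      then have "real_of_int k4 \<le> - 1" by linarith
      then have neg: "x3 + y2 < - 1" using c4 by (simp add: x4 y4)
      show False
      proof (cases "3 \<le> y2")
        case True
        then have "3 \<le> real_of_int y2" by linarith
        then show False using neg c3 ty2 tl by simp
      next
        case False
        then have "x2 \<le> 0" "y2 = 1" using y2_3 y2_pos \<open>y2 = 1 \<or> 3 \<le> y2\<close> by auto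
        moreover have "k3 = 0"
        proof (rule ccontr)
          assume "k3 \<noteq> 0"
          then have "1 \<le> real_of_int k3" using k3 by linarith
          then have "(2 + 2 * ?t) * (k3 - 1) \<ge> 0" using tl by simp
          then show False using c3(1) \<open>x2 \<le> 0\<close> \<open>y2 = 1\<close> tl by (simp add: x3 algebra_simps)
        qed
        ultimately show False using neg c2 tl by (simp add: x3)
      qed
    qed
    \<comment> \<open>below the line through north and east and above the fourth strip only points on the upper left remain\<close>
    have below: "X < 0 \<and> X + 1 < Y \<and> 2 < Y" if "X + ?t * Y < ?t" "3 < X + Y" for X Y :: real
    proof -
      have "0 < Y"
      proof (rule ccontr)
        assume "\<not> 0 < Y"
        then have "Y \<le> 4 * (?t * Y)" by (intro tail_length_mult_nonpos) simp
        then show False using that tl \<open>\<not> 0 < Y\<close> by simp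
      qed
      then have "0 \<le> ?t * Y" using tail_length_mult_nonneg[of Y] by simp
      then have "2 < Y" using that tl by linarith
      then have "0 \<le> ?t * (Y - 2)" by (intro tail_length_mult_nonneg) simp
      then have "2 * ?t \<le> ?t * Y" by (simp add: algebra_simps)
      then have "X < 0" using that tl by linarith
      then show ?thesis using \<open>2 < Y\<close> by simp
    qed
    have descent: "X + ?t * Y < ?t" "3 < X + Y"
      if "X = x3 - 2 * real i" "Y = y2 - 2 * real i" "i < nat k4" for X Y i
    proof -
      have "0 \<le> ?t * real i" using tl by simp
      moreover have "?t * Y = ?t * y2 - 2 * (?t * real i)" unfolding that(2) by (simp add: algebra_simps)
      ultimately show "X + ?t * Y < ?t" using c3(2) that(1) by linarith
      have "real i + 1 \<le> k4" using that(3) by linarith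
      then show "3 < X + Y" using c4(1) that by (simp add: x4 y4)
    qed
    have stage4: "reaches (pt x3 y2) (pt x4 y4)"
    proof -
      have "reaches (pt (x3 - 2 * real 0) (y2 - 2 * real 0)) (pt (x3 - 2 * real (nat k4)) (y2 - 2 * real (nat k4)))"
      proof (rule reaches_iterate)
        fix i assume i: "i < nat k4"
        define X Y where "X = x3 - 2 * real i" and "Y = y2 - 2 * real i"
        note d = descent[OF X_def Y_def i]
        note b = below[OF d]
        have "billiard (pt X Y) (pt (- X) (2 - Y))"
          by (rule reflect_north) (use d b in auto)
        moreover have "billiard (pt (- X) (2 - Y)) (pt (- 2 - (- X)) (- (2 - Y)))"
          by (rule reflect_west) (use d b in auto)
        ultimately show "reaches (pt (x3 - 2 * real i) (y2 - 2 * real i)) (pt (x3 - 2 * real (Suc i)) (y2 - 2 * real (Suc i)))"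
          unfolding X_def Y_def by (rule reaches2) (simp add: algebra_simps)
      qed
      then show ?thesis using k4 x4 y4 by simp
    qed
    have strip: "x4 + ?t * y4 < ?t"
    proof -
      have "0 \<le> ?t * k4" "0 \<le> real_of_int k4" using tl k4 by simp_all
      moreover have "x4 + ?t * y4 = x3 + ?t * y2 - 2 * k4 - 2 * (?t * k4)"
        by (simp add: x4 y4 algebra_simps)
      ultimately show ?thesis using c3(2) by linarith
    qed
    have y4_pos: "1 \<le> y4"
    proof (rule ccontr)
      assume "\<not> 1 \<le> y4"
      moreover have "odd y4" using y2_odd by (simp add: y4)
      ultimately have "y4 \<le> - 3 \<or> y4 = - 1" by presburger
      then show False
      proof
        assume "y4 \<le> - 3"
        then have "real_of_int y4 \<le> - 3" by linarith
        moreover then have "y4 \<le> 4 * (?t * y4)" by (intro tail_length_mult_nonpos) simp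
        ultimately show False using strip c4 tl by simp
      next
        assume y4m: "y4 = - 1"
        then have "k4 \<noteq> 0" using y2_pos y4 by auto
        then have "nat k4 - 1 < nat k4" "real (nat k4 - 1) = k4 - 1" using k4 by auto
        then show False using below[OF descent[OF refl refl, of "nat k4 - 1"]] y4m by (simp add: y4)
      qed
    qed
    then have "0 \<le> ?t * (y4 - 1)" by (intro tail_length_mult_nonneg) simp
    then have x4_neg: "x4 < 0" using strip by (simp add: algebra_simps)
    have k5: "k5 \<le> 0" using y5 y4_pos by auto
    have stage5: "reaches (pt x4 y4) (pt x4 y5)"
    proof -
      have "reaches (pt x4 (y4 - 4 * real 0)) (pt x4 (y4 - 4 * real (nat (- k5))))"
      proof (rule reaches_iterate)
        fix i assume i: "i < nat (- k5)"
        define Y where "Y = y4 - 4 * real i"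
        have "real i + 1 \<le> - k5" using i by linarith
        then have Y: "3 \<le> Y" using y5 by (auto simp: Y_def)
        have "0 \<le> ?t * real i" using tl by simp
        then have s: "x4 + ?t * Y < ?t" using strip by (simp add: Y_def algebra_simps)
        have t: "0 \<le> ?t * (Y - 3)" using Y by (intro tail_length_mult_nonneg) simp
        have "billiard (pt x4 Y) (pt (- x4) (2 - Y))"
          by (rule reflect_north) (use s x4_neg Y in auto)
        moreover have "billiard (pt (- x4) (2 - Y)) (pt (- (- x4)) (- 2 - (2 - Y)))"
          by (rule reflect_south) (use s t x4_neg Y c4 in \<open>auto simp: Y_def algebra_simps\<close>)
        ultimately show "reaches (pt x4 (y4 - 4 * real i)) (pt x4 (y4 - 4 * real (Suc i)))"
          unfolding Y_def by (rule reaches2) (simp add: algebra_simps)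
      qed
      then show ?thesis using k5 y5 by simp
    qed
    show ?thesis using stage1 stage2 stage3 stage4 stage5 x4_neg by (meson rtranclp_trans)
  qed
qed

text \<open>To the left of the kite the same strips are entered in the same order with the opposite
  translations: reflections in north and south, west and south, west and east, west and north,
  south and north. All step numbers now have the opposite sign. The exceptional points are those
  with \<open>y = 1\<close> and \<open>-2t < x < 0\<close>, which reflect in north and then in
  east.\<close>

lemma lower_half_turn:
  fixes x x2 x3 x4 :: real and y0 y1 y2 y4 y5 k1 k2 k3 k4 k5 :: int
  assumes x: "x < 0" and y0: "y0 = 1 \<or> y0 = -1"
    and y1: "y1 = y0 + 4 * k1" and c1: "- 1 < x - y1" "x - y1 < 3"
    and x2: "x2 = x - 2 * k2" and y2: "y2 = y1 + 2 * k2"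
    and c2: "- tail_length < tail_length * y2 - x2" "tail_length * y2 - x2 < tail_length + 2"
    and x3: "x3 = x2 - (2 + 2 * tail_length) * k3"
    and c3: "- tail_length - 2 < x3 + tail_length * y2" "x3 + tail_length * y2 < tail_length"
    and x4: "x4 = x3 - 2 * k4" and y4: "y4 = y2 - 2 * k4" and c4: "- 1 < x4 + y4" "x4 + y4 < 3"
    and y5: "y5 = y4 + 4 * k5" "y5 = 1 \<or> y5 = -1"
  shows "reaches (pt x y0) (pt x4 y5) \<and> 0 < x4"
proof (cases "y0 = 1 \<and> - 2 * tail_length \<le> x")
  \<comment> \<open>the boundary value \<open>x = -2t\<close> is excluded by \<open>c2\<close>, once \<open>k2 = 1\<close> is known\<close>
  case True
  let ?t = tail_length
  note tl = tail_length_bounds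
  have y0_1: "y0 = 1" and x_ge: "- 2 * ?t \<le> x" using True by auto
  have y1_m3: "y1 = - 3"
  proof -
    have "real_of_int k1 < 0" "- 2 < real_of_int k1" using c1 x x_ge tl y0_1 by (auto simp: y1)
    then have "k1 = - 1" by linarith
    then show ?thesis using y1 y0_1 by simp
  qed
  have e2: "?t * y2 - x2 = 2 * (?t * k2) - 3 * ?t - x + 2 * k2" by (simp add: x2 y2 y1_m3 algebra_simps)
  have k2: "k2 = 1"
  proof -
    have "\<not> k2 \<le> 0"
    proof
      assume "k2 \<le> 0"
      then have "?t * k2 \<le> 0" "real_of_int k2 \<le> 0" by (auto intro: tail_length_mult_nonpos)
      then show False using c2(1) e2 x_ge by simp
    qed
    moreover have "\<not> 2 \<le> k2"
    proof
      assume "2 \<le> k2"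
      then have k: "2 \<le> real_of_int k2" by linarith
      then have "0 \<le> ?t * (k2 - 2)" by (intro tail_length_mult_nonneg) simp
      then have "2 * ?t \<le> ?t * k2" by (simp add: algebra_simps)
      then show False using c2(2) e2 x tl k by linarith
    qed
    ultimately show ?thesis by simp
  qed
  then have x_gt: "- 2 * ?t < x" using c2(2) e2 by simp
  have xy2: "x2 = x - 2" "y2 = - 1" by (simp_all add: x2 y2 k2 y1_m3)
  have k3: "k3 = - 1"
  proof -
    have "\<not> 0 \<le> k3"
    proof
      assume "0 \<le> k3"
      then have "0 \<le> ?t * k3" "0 \<le> real_of_int k3" by (auto intro: tail_length_mult_nonneg)
      then show False using c3(1) xy2 x by (simp add: x3 algebra_simps)
    qed
    moreover have "\<not> k3 \<le> - 2"
    proof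
      assume "k3 \<le> - 2"
      then have k: "real_of_int k3 \<le> - 2" by linarith
      then have "?t * (k3 + 2) \<le> 0" by (intro tail_length_mult_nonpos) simp
      then have "?t * k3 \<le> - 2 * ?t" by (simp add: algebra_simps)
      moreover have "x3 = x - 2 - 2 * k3 - 2 * (?t * k3)" by (simp add: x3 xy2 algebra_simps)
      moreover have "?t * y2 = - ?t" by (simp add: xy2)
      ultimately show False using c3(2) k x_gt tl by linarith
    qed
    ultimately show ?thesis by simp
  qed
  have k4: "k4 = 0"
  proof -
    have e: "x4 + y4 = x + 2 * ?t - 1 - 4 * k4" by (simp add: x4 y4 x3 k3 xy2)
    have "real_of_int k4 < 1" "- 1 < real_of_int k4" using c4 e x x_gt tl by auto
    then show ?thesis by linarith
  qed
  have x4_eq: "x4 = x + 2 * ?t" by (simp add: x4 x3 xy2 k3 k4)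
  have "y5 = - 1 + 4 * k5" using y5 by (simp add: y4 k4 xy2)
  then have "y5 = - 1" using y5(2) by presburger
  moreover have "billiard (pt x 1) (pt (- x) (2 - 1))"
    by (rule reflect_north) (use x in auto)
  moreover have "billiard (pt (- x) (2 - 1)) (pt (2 * ?t - (- x)) (- (2 - 1)))"
    by (rule reflect_east) (use x x_gt in auto)
  ultimately have "reaches (pt x y0) (pt x4 y5)" using y0_1 x4_eq by (auto intro!: reaches2 simp: add.commute)
  then show ?thesis using x4_eq x_gt by simp
next
  case False
  let ?t = tail_length
  note tl = tail_length_bounds
  have x_lt: "y0 = - 1 \<or> x < - 2 * ?t" using False y0 by auto
  have k1: "k1 \<le> 0"
  proof (rule ccontr)
    assume "\<not> k1 \<le> 0"
    then have "1 \<le> real_of_int k1" by linarith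
    then show False using c1(1) x y0 y1 by auto
  qed
  have y1_le: "y1 \<le> - 1"
  proof -
    have "real_of_int y1 < 1" using c1(1) x by simp
    moreover have "odd y1" using y0 y1 by auto
    ultimately show ?thesis by presburger
  qed
  have k2: "k2 \<le> 0"
  proof (rule ccontr)
    assume "\<not> k2 \<le> 0"
    then have "1 \<le> k2" by simp
    then have k: "1 \<le> real_of_int k2" by linarith
    then have "0 \<le> ?t * (k2 - 1)" by (intro tail_length_mult_nonneg) simp
    then have "?t \<le> ?t * k2" by (simp add: algebra_simps)
    then have neg: "?t * (real_of_int y1 + 1) < x"
      using c2(2) k by (simp add: x2 y2 algebra_simps)
    have "y1 = - 1 \<or> y1 = - 3 \<and> y0 = 1 \<or> y1 \<le> - 5" using y1_le y1 y0 by presburger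
    then consider "y1 = - 1" | "y1 = - 3" "y0 = 1" | "y1 \<le> - 5" by blast
    then show False
    proof cases
      case 1 then show False using neg x by simp
    next
      case 2 then show False using neg x_lt by simp
    next
      case 3
      then have y: "real_of_int y1 \<le> - 5" by linarith
      then have "real_of_int y1 + 1 \<le> 4 * (?t * (real_of_int y1 + 1))" by (intro tail_length_mult_nonpos) simp
      then have "real_of_int y1 + 1 < 4 * x" using neg by linarith
      then show False using c1 y by linarith
    qed
  qed
  have y2_le: "y2 \<le> - 1" using y1_le k2 y2 by simp
  then have ty2: "?t * y2 \<le> 0" "y2 \<le> 4 * (?t * y2)" "?t * (y2 + 1) \<le> 0"
    using tail_length_mult_nonpos[of "real_of_int y2"] tail_length_mult_nonpos[of "real_of_int y2 + 1"] by auto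
  have y2_odd: "odd y2" unfolding y2 y1 using y0 by auto
  have y2_real: "real_of_int y2 \<le> - 1" using y2_le by linarith
  have k3: "k3 \<le> 0"
  proof (rule ccontr)
    assume "\<not> k3 \<le> 0"
    then have k: "1 \<le> real_of_int k3" by linarith
    then have "0 \<le> ?t * (k3 - 1)" by (intro tail_length_mult_nonneg) simp
    then have "?t \<le> ?t * k3" by (simp add: algebra_simps)
    moreover have "x3 = x2 - 2 * k3 - 2 * (?t * k3)" by (simp add: x3 algebra_simps)
    ultimately show False using c3(1) c2(1) ty2 k by linarith
  qed
  have k4: "k4 \<le> 0"
  proof (rule ccontr)
    assume "\<not> k4 \<le> 0"
    then have "1 \<le> real_of_int k4" by linarith
    then show False using c4(1) c3(2) ty2 y2_real tl by (simp add: x4 y4)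
  qed
  have stage1: "reaches (pt x y0) (pt x y1)"
  proof -
    have "reaches (pt x (y0 - 4 * real 0)) (pt x (y0 - 4 * real (nat (- k1))))"
    proof (rule reaches_iterate)
      fix i assume i: "i < nat (- k1)"
      define Y where "Y = y0 - 4 * real i"
      have "real i + 1 \<le> - k1" using i by linarith
      then have Y: "Y \<le> 1" "x + 1 < Y" using y0 y1 c1(2) by (auto simp: Y_def)
      have t: "?t * (Y - 1) \<le> 0" using Y by (intro tail_length_mult_nonpos) simp
      have south: "?t * (3 - Y) < - x"
      proof (cases "Y \<le> - 1")
        case True
        have "4 * (?t * (3 - Y)) \<le> 3 - Y" using Y by (intro tail_length_mult_nonneg) simp
        then show ?thesis using Y True by linarith
      next
        case False
        then have "i = 0" "y0 = 1" using y0 by (auto simp: Y_def)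
        then show ?thesis using x_lt by (simp add: Y_def)
      qed
      have "billiard (pt x Y) (pt (- x) (2 - Y))"
        by (rule reflect_north) (use t Y x in \<open>auto simp: algebra_simps\<close>)
      moreover have "billiard (pt (- x) (2 - Y)) (pt (- (- x)) (- 2 - (2 - Y)))"
        by (rule reflect_south) (use south Y x in \<open>auto simp: algebra_simps\<close>)
      ultimately show "reaches (pt x (y0 - 4 * real i)) (pt x (y0 - 4 * real (Suc i)))"
        unfolding Y_def by (rule reaches2) (simp add: algebra_simps)
    qed
    then show ?thesis using k1 y1 by simp
  qed
  have stage2: "reaches (pt x y1) (pt x2 y2)"
  proof -
    have "reaches (pt (x + 2 * real 0) (y1 - 2 * real 0)) (pt (x + 2 * real (nat (- k2))) (y1 - 2 * real (nat (- k2))))"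
    proof (rule reaches_iterate)
      fix i assume i: "i < nat (- k2)"
      define X Y j where "X = x + 2 * real i" and "Y = y1 - 2 * real i" and "j = - real_of_int k2 - real i"
      have j: "1 \<le> j" using i unfolding j_def by linarith
      have XY: "- 1 < X - Y" using c1 by (auto simp: X_def Y_def)
      have e: "x2 = X + 2 * j" "y2 = Y - 2 * j" by (simp_all add: X_def Y_def j_def x2 y2)
      have t: "?t * (j - 1) \<ge> 0" using j by (intro tail_length_mult_nonneg) simp
      have Y: "Y \<le> - 1" using y1_le by (simp add: Y_def)
      then have tY: "?t * Y \<le> 0" by (intro tail_length_mult_nonpos) simp
      have "?t * y2 = ?t * Y - 2 * (?t * j)" unfolding e by (simp add: algebra_simps)
      then have X: "X < ?t * Y - ?t - 2" using c2(1) t j e by (simp add: algebra_simps)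
      have "billiard (pt X Y) (pt (- 2 - X) (- Y))"
        by (rule reflect_west) (use X XY Y tY tl in auto)
      moreover have "billiard (pt (- 2 - X) (- Y)) (pt (- (- 2 - X)) (- 2 - (- Y)))"
        by (rule reflect_south) (use X XY Y tY tl in auto)
      ultimately show "reaches (pt (x + 2 * real i) (y1 - 2 * real i))
          (pt (x + 2 * real (Suc i)) (y1 - 2 * real (Suc i)))"
        unfolding X_def Y_def by (rule reaches2) (simp add: algebra_simps)
    qed
    then show ?thesis using k2 x2 y2 by simp
  qed
  have stage3: "reaches (pt x2 y2) (pt x3 y2)"
  proof -
    have "reaches (pt (x2 + (2 + 2 * ?t) * real 0) y2) (pt (x2 + (2 + 2 * ?t) * real (nat (- k3))) y2)"
    proof (rule reaches_iterate)
      fix i assume i: "i < nat (- k3)"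
      define X j where "X = x2 + (2 + 2 * ?t) * real i" and "j = - real_of_int k3 - real i"
      have j: "1 \<le> j" using i unfolding j_def by linarith
      have e: "x3 = X + (2 + 2 * ?t) * j" by (simp add: X_def j_def x3 algebra_simps)
      have X_ge: "x2 \<le> X" using tl by (simp add: X_def)
      have "(2 + 2 * ?t) * (j - 1) \<ge> 0" using j tl by simp
      then have X: "X + ?t * y2 < - ?t - 2" using c3(2) unfolding e by (simp add: algebra_simps)
      have XY: "- 1 < X - y2"
      proof (cases "y2 = - 1")
        case True
        then have "k2 = 0" "y1 = - 1" using y1_le k2 y2 by auto
        then show ?thesis using c1 X_ge True by (simp add: x2)
      next
        case False
        then have "y2 \<le> - 3" using y2_le y2_odd by presburger
        then have "real_of_int y2 \<le> - 3" by linarith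
        then show ?thesis using c2(2) X_ge ty2 tl by linarith
      qed
      have "billiard (pt X y2) (pt (- 2 - X) (- real_of_int y2))"
        by (rule reflect_west; use X XY y2_real ty2 tl in linarith)
      moreover have "billiard (pt (- 2 - X) (- real_of_int y2)) (pt (2 * ?t - (- 2 - X)) (- (- real_of_int y2)))"
        by (rule reflect_east) (use X XY c2(2) X_ge y2_real in auto)
      ultimately show "reaches (pt (x2 + (2 + 2 * ?t) * real i) y2) (pt (x2 + (2 + 2 * ?t) * real (Suc i)) y2)"
        unfolding X_def by (rule reaches2) (simp add: algebra_simps)
    qed
    then show ?thesis using k3 unfolding x3 by (simp add: algebra_simps)
  qed
  have ascent: "X + Y < - 1" "- ?t - 2 < X + ?t * Y" "Y \<le> - 1" "- 2 < X"
    if "X = x3 + 2 * real i" "Y = y2 + 2 * real i" "i < nat (- k4)" for X Y i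
  proof -
    have "real i + 1 \<le> - k4" using that(3) by linarith
    then show s: "X + Y < - 1" using c4(2) that by (simp add: x4 y4)
    have "0 \<le> ?t * real i" using tl by simp
    moreover have "?t * Y = ?t * y2 + 2 * (?t * real i)" unfolding that(2) by (simp add: algebra_simps)
    ultimately show a: "- ?t - 2 < X + ?t * Y" using c3(1) that(1) by linarith
    show Y: "Y \<le> - 1"
    proof (rule ccontr)
      assume "\<not> Y \<le> - 1"
      then have "\<not> y2 + 2 * int i \<le> - 1" using that(2) by linarith
      then have "1 \<le> y2 + 2 * int i" using y2_odd by presburger
      then have Y: "1 \<le> Y" using that(2) by linarith
      then have "1 \<le> real i" using that(2) y2_real by linarith
      then have "0 \<le> ?t * (real i - 1)" by (intro tail_length_mult_nonneg) simp
      then have "?t \<le> ?t * real i" by (simp add: algebra_simps)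
      moreover have "4 * (?t * Y) \<le> Y" using Y by (intro tail_length_mult_nonneg) simp
      moreover have "X + ?t * Y = x3 + ?t * y2 + 2 * real i + 2 * (?t * real i)"
        using that by (simp add: algebra_simps)
      ultimately show False using c3(1) s Y \<open>1 \<le> real i\<close> tl by linarith
    qed
    have "?t * (Y + 1) \<le> 0" using Y by (intro tail_length_mult_nonpos) simp
    then show "- 2 < X" using a by (simp add: algebra_simps)
  qed
  have stage4: "reaches (pt x3 y2) (pt x4 y4)"
  proof -
    have "reaches (pt (x3 + 2 * real 0) (y2 + 2 * real 0)) (pt (x3 + 2 * real (nat (- k4))) (y2 + 2 * real (nat (- k4))))"
    proof (rule reaches_iterate)
      fix i assume i: "i < nat (- k4)"
      define X Y where "X = x3 + 2 * real i" and "Y = y2 + 2 * real i"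
      note a = ascent[OF X_def Y_def i]
      have "billiard (pt X Y) (pt (- 2 - X) (- Y))"
        by (rule reflect_west) (use a in auto)
      moreover have "billiard (pt (- 2 - X) (- Y)) (pt (- (- 2 - X)) (2 - (- Y)))"
        by (rule reflect_north) (use a in auto)
      ultimately show "reaches (pt (x3 + 2 * real i) (y2 + 2 * real i)) (pt (x3 + 2 * real (Suc i)) (y2 + 2 * real (Suc i)))"
        unfolding X_def Y_def by (rule reaches2) (simp add: algebra_simps)
    qed
    then show ?thesis using k4 x4 y4 by simp
  qed
  have end_pos: "y4 \<le> 1 \<and> 0 < x4"
  proof (cases "k4 = 0")
    case True
    then show ?thesis using y2_le y2_real c4(1) by (simp add: y4)
  next
    case False
    then have n: "nat (- k4) - 1 < nat (- k4)" "real (nat (- k4) - 1) = - k4 - 1" using k4 by auto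
    have "x3 + 2 * real (nat (- k4) - 1) = x4 - 2" "y2 + 2 * real (nat (- k4) - 1) = y4 - 2"
      unfolding n(2) by (simp_all add: x4 y4)
    then have "- 2 < x4 - 2" "real_of_int y4 - 2 \<le> - 1"
      using ascent(3,4)[OF refl refl n(1)] by simp_all
    then show ?thesis by linarith
  qed
  have k5: "0 \<le> k5" using y5 end_pos by auto
  have stage5: "reaches (pt x4 y4) (pt x4 y5)"
  proof -
    have "reaches (pt x4 (y4 + 4 * real 0)) (pt x4 (y4 + 4 * real (nat k5)))"
    proof (rule reaches_iterate)
      fix i assume i: "i < nat k5"
      define Y where "Y = y4 + 4 * real i"
      have "real i + 1 \<le> k5" using i by linarith
      then have Y: "Y \<le> - 3" using y5 by (auto simp: Y_def)
      have t: "Y + 3 \<le> 4 * (?t * (Y + 3))" "?t * (Y + 3) \<le> 0"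
        using Y tail_length_mult_nonpos[of "Y + 3"] by simp_all
      have XY: "- 1 < x4 + Y" using c4 by (simp add: Y_def)
      have "billiard (pt x4 Y) (pt (- x4) (- 2 - Y))"
        by (rule reflect_south) (use t XY Y end_pos tl in \<open>auto simp: algebra_simps\<close>)
      moreover have "billiard (pt (- x4) (- 2 - Y)) (pt (- (- x4)) (2 - (- 2 - Y)))"
        by (rule reflect_north) (use t XY Y end_pos tl in \<open>auto simp: algebra_simps\<close>)
      ultimately show "reaches (pt x4 (y4 + 4 * real i)) (pt x4 (y4 + 4 * real (Suc i)))"
        unfolding Y_def by (rule reaches2) (simp add: algebra_simps)
    qed
    then show ?thesis using k5 y5 by simp
  qed
  show ?thesis using stage1 stage2 stage3 stage4 stage5 end_pos by (meson rtranclp_trans)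
qed

section \<open>Half turns in strip coordinates\<close>

type_synonym strip_coords = "int \<times> int \<times> int \<times> int"
type_synonym turn = "int \<times> int \<times> int \<times> int"

text \<open>The coordinates \<open>(a, b, y, z)\<close> stand for the point with abscissa \<open>x = a +
  b\<phi>\<close> on one of the lines \<open>y = 1\<close> and \<open>y = -1\<close>. The
  integer \<open>y\<close> is only congruent modulo 4 to the true ordinate: it is the ordinate
  at which the first block of translations ends in its strip. The integer \<open>z\<close>
  carries no information about the point. Both \<open>y\<close> and \<open>z\<close> are lifts,
  chosen to make the forms below bounded. The parities hold along the orbit of
  \<open>(\<phi>\<^sup>-\<^sup>2, -1)\<close> and keep it off the lines where the map is
  undefined.\<close>

definition admissible :: "strip_coords \<Rightarrow> bool" where
  "admissible = (\<lambda>(a, b, y, z). even a \<and> odd b \<and> odd y)"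

definition location :: "strip_coords \<Rightarrow> real^2" where
  "location = (\<lambda>(a, b, y, z). pt (a + b * golden_ratio) (if y mod 4 = 1 then 1 else - 1))"

text \<open>In terms of the step numbers of the half turn, \<open>i = k3 - k2\<close> and \<open>j = k4 -
  k3\<close>; these differences are bounded while the step numbers grow with the abscissa. The
  integers \<open>l\<close> and \<open>m\<close> are free: they choose the lifts of the new
  point.\<close>

fun half_turn :: "turn \<Rightarrow> strip_coords \<Rightarrow> strip_coords" where
  "half_turn (i, j, l, m) (a, b, y, z) =
     (a + 2 * i - 2 * j, b - 4 * z - 2 + 2 * y - 4 * i, 2 - y - 2 * i - 2 * j + 4 * l, m - z)"

text \<open>For \<open>x = a + b\<phi>\<close> the four forms are \<open>\<phi>(x + y) - 4z\<close>,
  \<open>x + \<surd>5 y - 4z\<close>, \<open>x/\<phi> + \<phi>\<^sup>2 y - 4z\<close> and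
  \<open>x - y\<close>. The last one is the form of the first strip. The other three are the
  forms of the second, third and fourth strip at the end of their blocks, up to a factor and a
  term that depends on \<open>i\<close> and \<open>j\<close> only. Only two of them are
  independent: \<open>C = A - D\<close> and \<open>B = A - D/\<phi>\<close>.\<close>

definition form_A :: "strip_coords \<Rightarrow> real" where
  "form_A = (\<lambda>(a, b, y, z). (b - 4 * z) + (a + b + y) * golden_ratio)"
definition form_B :: "strip_coords \<Rightarrow> real" where
  "form_B = (\<lambda>(a, b, y, z). (a - y - 4 * z) + (b + 2 * y) * golden_ratio)"
definition form_C :: "strip_coords \<Rightarrow> real" where
  "form_C = (\<lambda>(a, b, y, z). (b - a + y - 4 * z) + (a + y) * golden_ratio)"
definition form_D :: "strip_coords \<Rightarrow> real" where
  "form_D = (\<lambda>(a, b, y, z). (a - y) + b * golden_ratio)"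

lemma odd_mod_4:
  fixes y :: int
  assumes "odd y"
  obtains k where "y = (if y mod 4 = 1 then 1 else - 1) + 4 * k"
proof -
  have "y mod 4 = 1 \<or> y mod 4 = 3" using assms by presburger
  then show thesis
  proof
    assume 1: "y mod 4 = 1"
    then have "y = 1 + 4 * (y div 4)" by presburger
    then show thesis using 1 that by simp
  next
    assume 3: "y mod 4 = 3"
    then have "y = - 1 + 4 * (y div 4 + 1)" by presburger
    then show thesis using 3 that[of "y div 4 + 1"] by simp
  qed
qed

text \<open>The bounds on the forms \<open>D\<close>, \<open>A\<close>, \<open>B\<close>, \<open>C\<close>
  are the four strip conditions; \<open>eD\<close>, \<open>eA\<close>, \<open>eB\<close>,
  \<open>eC\<close> in the proof are the identities behind this. The weak bounds suffice because
  \<open>golden_strict\<close> makes them strict.\<close>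

lemma half_turn_reaches:
  assumes adm: "admissible s"
    and D: "- 1 \<le> form_D s" "form_D s \<le> 3"
    and A: "- golden_ratio \<le> form_A s" "form_A s \<le> 4 - golden_ratio"
    and B: "4 * i * (golden_ratio - 1) \<le> form_B s + tail_length"
      "form_B s + tail_length \<le> 4 * (i + 1) * (golden_ratio - 1)"
    and C: "4 * j \<le> golden_ratio * form_C s - 2 * golden_ratio + 1 - 4 * i * golden_ratio"
      "golden_ratio * form_C s - 2 * golden_ratio + 1 - 4 * i * golden_ratio \<le> 4 * (j + 1)"
  shows "reaches (location s) (location (half_turn (i, j, l, m) s)) \<and> admissible (half_turn (i, j, l, m) s)"
proof -
  obtain a b y z where s: "s = (a, b, y, z)" by (cases s)
  let ?g = golden_ratio
  have par: "even a" "odd b" "odd y" using adm by (auto simp: s admissible_def)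
  define x where "x = a + b * ?g"
  define y0 where "y0 = (if y mod 4 = 1 then 1 else - 1 :: int)"
  obtain k1 where k1: "y = y0 + 4 * k1" using odd_mod_4[OF par(3)] unfolding y0_def .
  have "even (1 - y)" using par(3) by simp
  then obtain h where h: "1 - y = 2 * h" by (rule evenE)
  \<comment> \<open>the lift \<open>z\<close> is normalized by the number \<open>k2 = z + (1 - y)/2\<close> of steps in the second block\<close>
  define k2 k3 k4 where "k2 = z + h" and "k3 = k2 + i" and "k4 = k3 + j"
  define y2 y4 where "y2 = y + 2 * k2" and "y4 = y2 - 2 * k4"
  define x2 x3 x4 where "x2 = x - 2 * k2" and "x3 = x2 - (2 + 2 * tail_length) * k3" and "x4 = x3 - 2 * k4"
  have yr: "real_of_int y = 1 - 2 * h" using h by linarith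
  have k2r: "real_of_int k2 = z + h" by (simp add: k2_def)
  note gg = golden_ratio_reduce
  have eD: "form_D s = x - y" by (simp add: form_D_def s x_def)
  have eA: "tail_length * y2 - x2 = tail_length + 2 - (?g - 1) * (form_A s + ?g)"
    by (simp add: form_A_def s y2_def x2_def x_def tail_length_def yr k2r gg algebra_simps)
  have eB: "x3 + tail_length * y2 + tail_length + 2 = form_B s + tail_length - 4 * i * (?g - 1)"
    by (simp add: form_B_def s y2_def x3_def x2_def x_def k3_def tail_length_def yr k2r gg algebra_simps)
  have eC: "x4 + y4 + 1 = ?g * form_C s - 2 * ?g + 1 - 4 * i * ?g - 4 * j"
    by (simp add: form_C_def s y2_def y4_def x4_def x3_def x2_def x_def k4_def k3_def tail_length_def
        yr k2r gg algebra_simps)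
  have t2: "2 + 2 * tail_length = 4 * (?g - 1)" by (simp add: tail_length_def)
  have g1: "?g - 1 > 0" using golden_ratio_bounds by simp
  have strict: "0 < t" if "t = p + q * ?g" "0 \<le> t" "odd q" for t :: real and p q :: int
    using that golden_strict[of p q] by simp
  have D': "- 1 < x - y" "x - y < 3"
  proof -
    have "0 < form_D s + 1"
      by (rule strict[of _ "a - y + 1" b]) (use D par in \<open>auto simp: form_D_def s\<close>)
    moreover have "0 < 3 - form_D s"
      by (rule strict[of _ "3 - a + y" "- b"]) (use D par in \<open>auto simp: form_D_def s\<close>)
    ultimately show "- 1 < x - y" "x - y < 3" unfolding eD by simp_all
  qed
  have A': "0 < form_A s + ?g" "form_A s + ?g < 4"
  proof -
    show "0 < form_A s + ?g"
      by (rule strict[of _ "b - 4 * z" "a + b + y + 1"]) (use A par in \<open>auto simp: form_A_def s algebra_simps\<close>)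
    have "0 < 4 - ?g - form_A s"
      by (rule strict[of _ "4 - b + 4 * z" "- (a + b + y) - 1"]) (use A par in \<open>auto simp: form_A_def s algebra_simps\<close>)
    then show "form_A s + ?g < 4" by simp
  qed
  have B': "0 < form_B s + tail_length - 4 * i * (?g - 1)" "form_B s + tail_length - 4 * i * (?g - 1) < 4 * (?g - 1)"
  proof -
    show "0 < form_B s + tail_length - 4 * i * (?g - 1)"
      by (rule strict[of _ "a - y - 4 * z - 3 + 4 * i" "b + 2 * y + 2 - 4 * i"])
        (use B par in \<open>auto simp: form_B_def s tail_length_def algebra_simps\<close>)
    have "0 < 4 * (?g - 1) - (form_B s + tail_length - 4 * i * (?g - 1))"
      by (rule strict[of _ "- 4 - (a - y - 4 * z - 3 + 4 * i)" "4 - (b + 2 * y + 2 - 4 * i)"])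
        (use B par in \<open>auto simp: form_B_def s tail_length_def algebra_simps\<close>)
    then show "form_B s + tail_length - 4 * i * (?g - 1) < 4 * (?g - 1)" by simp
  qed
  have gC: "?g * form_C s = (a + y) + (b + 2 * y - 4 * z) * ?g"
    by (simp add: form_C_def s gg algebra_simps)
  have C': "0 < x4 + y4 + 1" "x4 + y4 + 1 < 4"
  proof -
    have e: "x4 + y4 + 1 = (a + y + 1 - 4 * j) + (b + 2 * y - 4 * z - 2 - 4 * i) * ?g"
      unfolding eC gC by (simp add: algebra_simps)
    show "0 < x4 + y4 + 1"
      by (rule strict[of _ "a + y + 1 - 4 * j" "b + 2 * y - 4 * z - 2 - 4 * i"])
        (use C par eC in \<open>auto simp: e simp del: of_int_add of_int_diff of_int_mult\<close>)
    have "0 < 4 - (x4 + y4 + 1)"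
    proof (rule strict[of _ "3 - a - y + 4 * j" "- (b + 2 * y - 4 * z - 2 - 4 * i)"])
      show "4 - (x4 + y4 + 1) = (3 - a - y + 4 * j) + (- (b + 2 * y - 4 * z - 2 - 4 * i)) * ?g"
        unfolding e by (simp add: algebra_simps)
    qed (use C eC par in auto)
    then show "x4 + y4 + 1 < 4" by simp
  qed
  define a' b' y' where "a' = a + 2 * i - 2 * j" and "b' = b - 4 * z - 2 + 2 * y - 4 * i"
    and "y' = 2 - y - 2 * i - 2 * j + 4 * l"
  have target: "half_turn (i, j, l, m) s = (a', b', y', m - z)"
    by (simp add: s a'_def b'_def y'_def)
  have adm': "admissible (a', b', y', m - z)"
    using par by (simp add: admissible_def a'_def b'_def y'_def)
  have x4_eq: "x4 = a' + b' * ?g"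
    by (simp add: x4_def x3_def x2_def x_def k4_def k3_def a'_def b'_def tail_length_def
        yr k2r gg algebra_simps)
  obtain n where n: "y' = (if y' mod 4 = 1 then 1 else - 1) + 4 * n"
    using odd_mod_4[of y'] adm' by (auto simp: admissible_def)
  define y5 where "y5 = (if y' mod 4 = 1 then 1 else - 1 :: int)"
  have "y5 = y4 + 4 * (h + l - n)"
  proof -
    have "y' = y5 + 4 * n" using n by (simp only: y5_def)
    then show ?thesis using h by (simp add: y'_def y4_def y2_def k4_def k3_def k2_def)
  qed
  have c2: "- tail_length < tail_length * y2 - x2" "tail_length * y2 - x2 < tail_length + 2"
  proof -
    have "0 < (?g - 1) * (form_A s + ?g)" using A' g1 by simp
    moreover have "(?g - 1) * (form_A s + ?g) < (?g - 1) * 4" using A' g1 by (intro mult_strict_left_mono) auto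
    ultimately show "- tail_length < tail_length * y2 - x2" "tail_length * y2 - x2 < tail_length + 2"
      unfolding eA using t2 by simp_all
  qed
  have c3: "- tail_length - 2 < x3 + tail_length * y2" "x3 + tail_length * y2 < tail_length"
    using B' eB t2 by simp_all
  have c4: "- 1 < x4 + y4" "x4 + y4 < 3" using C' by simp_all
  have y0': "y0 = 1 \<or> y0 = - 1" and y5': "y5 = 1 \<or> y5 = - 1" by (auto simp: y0_def y5_def)
  have x_ne: "x \<noteq> 0" using golden_ratio_eq_zero_iff[of a b] par by (auto simp: x_def)
  then have "x < 0 \<or> 0 < x" by auto
  then have "reaches (pt x y0) (pt x4 y5)"
    using upper_half_turn[OF _ y0' k1 D' x2_def y2_def c2 x3_def c3 x4_def y4_def c4 \<open>y5 = y4 + 4 * (h + l - n)\<close> y5']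
      lower_half_turn[OF _ y0' k1 D' x2_def y2_def c2 x3_def c3 x4_def y4_def c4 \<open>y5 = y4 + 4 * (h + l - n)\<close> y5']
    by blast
  moreover have "location s = pt x y0"
    by (simp add: location_def s x_def y0_def)
  moreover have "location (a', b', y', m - z) = pt x4 y5"
    by (simp add: location_def x4_eq y5_def)
  ultimately show ?thesis unfolding target using adm' by simp
qed

section \<open>Boxes of golden integers\<close>

type_synonym golden_int = "int \<times> int"
type_synonym box = "(golden_int \<times> golden_int) list"
type_synonym move = "box \<times> strip_coords"

fun golden_val :: "golden_int \<Rightarrow> real" where
  "golden_val (p, q) = p + q * golden_ratio"

fun golden_nonneg :: "golden_int \<Rightarrow> bool" where
  "golden_nonneg (p, q) \<longleftrightarrow>
     (if 0 \<le> p then 0 \<le> q \<or> q * q \<le> p * (p + q) else 0 < q \<and> p * (p + q) \<le> q * q)"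

text \<open>The product of \<open>p + q\<phi>\<close> with its conjugate is the integer \<open>p(p + q) -
  q\<^sup>2\<close>. When \<open>p\<close> and \<open>q\<close> have opposite signs the
  conjugate has the sign of \<open>p\<close>, so this norm decides.\<close>

lemma golden_nonneg_iff: "golden_nonneg w \<longleftrightarrow> 0 \<le> golden_val w"
proof -
  obtain p q where w: "w = (p, q)" by (cases w)
  let ?v = "p + q * golden_ratio" and ?c = "p + q * (1 - golden_ratio)"
  have norm: "?v * ?c = real_of_int (p * (p + q) - q * q)"
    by (simp add: golden_ratio_reduce algebra_simps)
  have g: "golden_ratio > 1" using golden_ratio_bounds by simp
  consider "0 \<le> p" "0 \<le> q" | "0 \<le> p" "q < 0" | "p < 0" "q \<le> 0" | "p < 0" "0 < q" by linarith
  then show ?thesis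
  proof cases
    case 1
    then show ?thesis using g by (simp add: w)
  next
    case 2
    then have "0 \<le> real_of_int p" "0 < q * (1 - golden_ratio)" using g by (simp_all add: mult_neg_neg)
    then have "0 < ?c" by linarith
    then have "0 \<le> ?v \<longleftrightarrow> 0 \<le> ?v * ?c" by (simp add: zero_le_mult_iff)
    also have "\<dots> \<longleftrightarrow> q * q \<le> p * (p + q)" unfolding norm by linarith
    finally show ?thesis using 2 by (simp add: w)
  next
    case 3
    then have "real_of_int p < 0" "q * golden_ratio \<le> 0" using g by (simp_all add: mult_nonpos_nonneg)
    then show ?thesis using 3 by (simp add: w)
  next
    case 4
    then have "real_of_int p < 0" "q * (1 - golden_ratio) < 0" using g by (simp_all add: mult_pos_neg)
    then have "?c < 0" by linarith
    then have "0 \<le> ?v \<longleftrightarrow> ?v * ?c \<le> 0" by (simp add: mult_le_0_iff)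
    also have "\<dots> \<longleftrightarrow> p * (p + q) \<le> q * q" unfolding norm by linarith
    finally show ?thesis using 4 by (simp add: w)
  qed
qed

definition golden_le :: "golden_int \<Rightarrow> golden_int \<Rightarrow> bool" where
  "golden_le v w \<longleftrightarrow> golden_nonneg (w - v)"

fun golden_times :: "golden_int \<Rightarrow> golden_int \<Rightarrow> golden_int" where
  "golden_times (p, q) (r, s) = (p * r + q * s, p * s + q * r + q * s)"

lemma golden_val_add [simp]: "golden_val (v + w) = golden_val v + golden_val w"
  by (cases v, cases w) (simp add: algebra_simps)

lemma golden_val_diff [simp]: "golden_val (v - w) = golden_val v - golden_val w"
  by (cases v, cases w) (simp add: algebra_simps)

lemma golden_val_times [simp]: "golden_val (golden_times v w) = golden_val v * golden_val w"
  by (cases v, cases w) (simp add: golden_ratio_reduce algebra_simps)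

lemma golden_le_iff: "golden_le v w \<longleftrightarrow> golden_val v \<le> golden_val w"
  by (simp add: golden_le_def golden_nonneg_iff)

fun forms :: "strip_coords \<Rightarrow> golden_int list" where
  "forms (a, b, y, z) =
     [(b - 4 * z, a + b + y), (a - y - 4 * z, b + 2 * y), (b - a + y - 4 * z, a + y), (a - y, b)]"

definition form_vals :: "strip_coords \<Rightarrow> real list" where
  "form_vals s = map golden_val (forms s)"

lemma form_vals_eq: "form_vals s = [form_A s, form_B s, form_C s, form_D s]"
  by (cases s) (simp add: form_vals_def form_A_def form_B_def form_C_def form_D_def)

lemma form_vals_add: "form_vals (s + t) = map2 (+) (form_vals s) (form_vals t)"
  by (cases s, cases t) (simp add: form_vals_def algebra_simps)

text \<open>A box bounds the four forms and thus describes an octagon, possibly with degenerate sides. The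
  parameter \<open>c\<close> scales it; a negative \<open>c\<close> reflects it as well.\<close>

definition in_box :: "real \<Rightarrow> box \<Rightarrow> real list \<Rightarrow> bool" where
  "in_box c B xs \<longleftrightarrow> list_all2 (\<lambda>(l, u) x. golden_val l \<le> x / c \<and> x / c \<le> golden_val u) B xs"

fun subbox :: "box \<Rightarrow> golden_int list \<Rightarrow> box \<Rightarrow> bool" where
  "subbox ((l, u) # B) (f # fs) ((l', u') # B') \<longleftrightarrow>
     golden_le l' (l + f) \<and> golden_le (u + f) u' \<and> subbox B fs B'"
| "subbox [] [] [] \<longleftrightarrow> True"
| "subbox _ _ _ \<longleftrightarrow> False"

lemma subbox_in_box:
  assumes "subbox B fs B'" "in_box c B xs" "c \<noteq> 0"
  shows "in_box c B' (map2 (\<lambda>x f. x + c * golden_val f) xs fs)"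
  using assms
proof (induction B fs B' arbitrary: xs rule: subbox.induct)
  case (1 l u B f fs l' u' B')
  obtain x ys where xs: "xs = x # ys" using "1.prems"(2) by (auto simp: in_box_def list_all2_Cons1)
  have "(x + c * golden_val f) / c = x / c + golden_val f" using "1.prems"(3) by (simp add: add_divide_distrib)
  then show ?case using 1 by (auto simp: xs in_box_def golden_le_iff)
qed (auto simp: in_box_def)

section \<open>Renormalization\<close>

text \<open>This is multiplication of all four forms by \<open>\<theta> = 3 - 2\<phi> =
  -\<phi>\<^sup>-\<^sup>3\<close>, see \<open>form_vals_expand\<close>. It contracts the forms,
  but as an integer matrix with \<open>\<theta>\<^sup>2 = 4\<theta> + 1\<close> it also has the
  conjugate eigenvalue \<open>\<phi>\<^sup>3\<close>, which acts on the abscissa.\<close>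

definition expand :: "strip_coords \<Rightarrow> strip_coords" where
  "expand = (\<lambda>(a, b, y, z). (3 * a - 2 * b - 2 * y + 4 * z, b - 2 * a + 2 * y, y + 4 * z, y + 3 * z))"

abbreviation theta :: real where "theta \<equiv> 3 - 2 * golden_ratio"

lemma theta_neg: "theta < 0" using golden_ratio_bounds by simp

lemma expand_add: "expand (s + t) = expand s + expand t"
  by (cases s, cases t) (simp add: expand_def)

lemma expand_zero: "expand 0 = 0"
  by (simp add: expand_def zero_prod_def)

lemma expand_pow_add: "(expand ^^ k) (s + t) = (expand ^^ k) s + (expand ^^ k) t"
  by (induction k) (simp_all add: expand_add)

lemma expand_pow_zero: "(expand ^^ k) 0 = 0"
  by (induction k) (simp_all add: expand_zero)

lemma expand_square: "expand (expand s) = expand s + expand s + expand s + expand s + s"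
  by (cases s) (simp add: expand_def)

lemma form_vals_expand: "form_vals (expand s) = map ((*) theta) (form_vals s)"
  by (cases s) (simp add: form_vals_def expand_def golden_ratio_reduce algebra_simps)

lemma form_vals_expand_pow: "form_vals ((expand ^^ k) s) = map ((*) (theta ^ k)) (form_vals s)"
  by (induction k) (simp_all add: form_vals_expand comp_def mult.assoc)

definition start :: strip_coords where "start = (2, - 1, - 1, 0)"

text \<open>A move is a box around the starting point, in relative coordinates, and a displacement. At level
  \<open>k\<close> both are scaled by \<open>\<theta>\<^sup>k\<close>.\<close>

definition leads :: "nat \<Rightarrow> move \<Rightarrow> bool" where
  "leads k = (\<lambda>(B, d). \<forall>s. admissible s \<longrightarrow> in_box (theta ^ k) B (form_vals (s - start)) \<longrightarrow>
     reaches (location s) (location (s + (expand ^^ k) d)) \<and> admissible (s + (expand ^^ k) d))"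

text \<open>The third argument is the word still to be performed after the displacement \<open>v\<close>.
  The translated box must stay inside the box of the next move as a whole, so that all its
  points perform the same word.\<close>

fun follows :: "box \<Rightarrow> strip_coords \<Rightarrow> move list \<Rightarrow> strip_coords \<Rightarrow> bool" where
  "follows B v [] d \<longleftrightarrow> v = d"
| "follows B v ((B', e) # ms) d \<longleftrightarrow> subbox B (forms v) B' \<and> follows B (v + e) ms d"

text \<open>Nothing changes when boxes and displacements are all scaled by \<open>\<theta>\<^sup>k\<close>,
  so one unscaled check serves all levels.\<close>

lemma follows_reaches:
  assumes "\<And>m. m \<in> set ms \<Longrightarrow> leads k m" "follows B v ms d"
    and "admissible (s + (expand ^^ k) v)" "in_box (theta ^ k) B (form_vals (s - start))"
  shows "reaches (location (s + (expand ^^ k) v)) (location (s + (expand ^^ k) d)) \<and>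
    admissible (s + (expand ^^ k) d)"
  using assms
proof (induction B v ms d rule: follows.induct)
  case (1 B v d)
  then show ?case by simp
next
  case (2 B v B' e ms d)
  let ?t = "s + (expand ^^ k) v"
  have next_eq: "s + (expand ^^ k) (v + e) = ?t + (expand ^^ k) e"
    by (simp add: expand_pow_add add.assoc)
  have "form_vals (?t - start) = form_vals (s - start + (expand ^^ k) v)"
    by (rule arg_cong[of _ _ form_vals]) simp
  also have "\<dots> = map2 (\<lambda>x f. x + theta ^ k * golden_val f) (form_vals (s - start)) (forms v)"
    unfolding form_vals_add form_vals_expand_pow form_vals_def[of v]
    by (simp add: zip_map2 comp_def case_prod_unfold)
  finally have vals: "form_vals (?t - start) = \<dots>" .
  have "in_box (theta ^ k) B' (form_vals (?t - start))"
    unfolding vals by (rule subbox_in_box) (use "2.prems"(2,4) theta_neg in auto)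
  moreover have "leads k (B', e)" using "2.prems"(1) by simp
  ultimately have step: "reaches (location ?t) (location (?t + (expand ^^ k) e)) \<and> admissible (?t + (expand ^^ k) e)"
    using "2.prems"(3) unfolding leads_def prod.case by blast
  then show ?case
    using "2.IH"[unfolded next_eq] "2.prems" by (auto intro: rtranclp_trans)
qed

text \<open>The endpoints of the intervals are exchanged because \<open>\<theta>\<close> is negative.\<close>

definition contract_box :: "box \<Rightarrow> box" where
  "contract_box = map (\<lambda>(l, u). (golden_times (3, - 2) u, golden_times (3, - 2) l))"

lemma in_box_contract:
  assumes "in_box (theta ^ Suc k) B xs"
  shows "in_box (theta ^ k) (contract_box B) xs"
proof -
  have "golden_val (golden_times (3, - 2) u) \<le> x / theta ^ k \<and>
      x / theta ^ k \<le> golden_val (golden_times (3, - 2) l)"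
    if "golden_val l \<le> x / theta ^ Suc k" "x / theta ^ Suc k \<le> golden_val u" for l u and x :: real
  proof -
    have e: "x / theta ^ k = theta * (x / theta ^ Suc k)" using theta_neg by simp
    have t: "golden_val (golden_times (3, - 2) w) = theta * golden_val w" for w by simp
    have neg: "theta \<le> 0" using theta_neg by simp
    show ?thesis unfolding e t
      by (intro conjI mult_left_mono_neg[OF that(1) neg] mult_left_mono_neg[OF that(2) neg])
  qed
  then show ?thesis
    using assms unfolding in_box_def contract_box_def list_all2_map1
    by (auto elim!: list_all2_mono simp del: golden_val_times power_Suc)
qed

text \<open>The renormalization step: at level \<open>k + 1\<close> a move is the contracted move at level
  \<open>k\<close>, and this is composed of moves that are already known to be realized at level
  \<open>k\<close>.\<close>

lemma leads_Suc:
  assumes "\<And>m. m \<in> set ms \<Longrightarrow> leads k m" "follows (contract_box B) 0 ms (expand d)"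
  shows "leads (Suc k) (B, d)"
  unfolding leads_def prod.case
proof (intro allI impI)
  fix s assume s: "admissible s" "in_box (theta ^ Suc k) B (form_vals (s - start))"
  have "(expand ^^ Suc k) d = (expand ^^ k) (expand d)" by (simp only: funpow_Suc_right comp_def)
  then show "reaches (location s) (location (s + (expand ^^ Suc k) d)) \<and> admissible (s + (expand ^^ Suc k) d)"
    using follows_reaches[OF assms _ in_box_contract[OF s(2)]] s(1)
    by (simp add: expand_pow_zero del: funpow.simps)
qed

section \<open>Full turns are piecewise translations\<close>

text \<open>The hypotheses of \<open>half_turn_reaches\<close> solved for the forms.\<close>

fun half_turn_domain :: "turn \<Rightarrow> box" where
  "half_turn_domain (i, j, l, m) =
     [((0, - 1), (4, - 1)),
      ((3 - 4 * i, 4 * i - 2), (- 1 - 4 * i, 4 * i + 2)),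
      ((3 + 4 * i - 4 * j, 4 * j - 1), (4 * i - 4 * j - 1, 4 * j + 3)),
      ((- 1, 0), (3, 0))]"

lemma half_turn_reaches_in_domain:
  assumes "admissible s" "in_box 1 (half_turn_domain p) (form_vals s)"
  shows "reaches (location s) (location (half_turn p s)) \<and> admissible (half_turn p s)"
proof -
  obtain i j l m where p: "p = (i, j, l, m)" by (cases p)
  let ?g = golden_ratio
  have C: "(3 + 4 * i - 4 * j) + (4 * j - 1) * ?g \<le> form_C s"
    "form_C s \<le> (4 * i - 4 * j - 1) + (4 * j + 3) * ?g"
    using assms(2) by (auto simp: p in_box_def form_vals_eq)
  have g: "?g > 0" using golden_ratio_bounds by simp
  have "?g * ((3 + 4 * i - 4 * j) + (4 * j - 1) * ?g) \<le> ?g * form_C s"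
    "?g * form_C s \<le> ?g * ((4 * i - 4 * j - 1) + (4 * j + 3) * ?g)"
    using C g by (simp_all add: mult_left_mono)
  then have C': "4 * j \<le> ?g * form_C s - 2 * ?g + 1 - 4 * i * ?g"
    "?g * form_C s - 2 * ?g + 1 - 4 * i * ?g \<le> 4 * (j + 1)"
    by (simp_all add: golden_ratio_reduce algebra_simps)
  show ?thesis unfolding p
    by (rule half_turn_reaches[OF assms(1)])
      (use assms(2) C' in \<open>auto simp: p in_box_def form_vals_eq tail_length_def algebra_simps\<close>)
qed

fun pull_interval :: "golden_int \<Rightarrow> golden_int \<Rightarrow> golden_int \<times> golden_int \<Rightarrow> golden_int \<times> golden_int" where
  "pull_interval r c (l, u) = (golden_times r (l - c), golden_times r (u - c))"

text \<open>A half turn acts on the forms by \<open>A' = \<phi> B + cA\<close>, \<open>D' = \<phi> C +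
  cD\<close>, \<open>B' = A/\<phi> + cA - cD/\<phi>\<close> and \<open>C' = D/\<phi> + cA -
  cD\<close>, so the preimage of a box is again a box, in which the roles of the forms are
  exchanged in pairs. The factor \<open>1/\<phi>\<close> is the golden integer \<open>(-1,
  1)\<close>.\<close>

fun half_turn_pullback :: "turn \<Rightarrow> box \<Rightarrow> box" where
  "half_turn_pullback (i, j, l, m) [IA, IB, IC, ID] =
     (let cA = (- 2 - 4 * i - 4 * m, - 4 * (i + j - l)); cD = (- 2 + 4 * i - 4 * l, - 2 - 4 * i)
      in [pull_interval (0, 1) (cA - golden_times (- 1, 1) cD) IB, pull_interval (- 1, 1) cA IA,
          pull_interval (- 1, 1) cD ID, pull_interval (0, 1) (cA - cD) IC])"
| "half_turn_pullback _ _ = []"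

lemma half_turn_pullback_in_box:
  assumes "in_box 1 (half_turn_pullback p B) (form_vals s)"
  shows "in_box 1 B (form_vals (half_turn p s))"
proof -
  obtain i j l m where p: "p = (i, j, l, m)" by (cases p)
  obtain a b y z where s: "s = (a, b, y, z)" by (cases s)
  let ?g = golden_ratio
  have "half_turn_pullback p B \<noteq> []" using assms by (auto simp: in_box_def form_vals_eq)
  then obtain lA uA lB uB lC uC lD uD where B: "B = [(lA, uA), (lB, uB), (lC, uC), (lD, uD)]"
    by (cases "(p, B)" rule: half_turn_pullback.cases) auto
  define cA cD :: golden_int where "cA = (- 2 - 4 * i - 4 * m, - 4 * (i + j - l))"
    and "cD = (- 2 + 4 * i - 4 * l, - 2 - 4 * i)"
  have forms: "form_A (half_turn p s) = ?g * form_B s + golden_val cA"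
    "form_D (half_turn p s) = ?g * form_C s + golden_val cD"
    "form_B (half_turn p s) = (?g - 1) * form_A s + golden_val cA - (?g - 1) * golden_val cD"
    "form_C (half_turn p s) = (?g - 1) * form_D s + golden_val cA - golden_val cD"
    by (simp_all add: p s form_A_def form_B_def form_C_def form_D_def cA_def cD_def
        golden_ratio_reduce algebra_simps)
  have g: "?g > 0" "?g - 1 > 0" "(?g - 1) * ?g = 1"
    using golden_ratio_bounds by (simp_all add: golden_ratio_reduce algebra_simps)
  have up: "(?g - 1) * (x - c) \<le> t \<longleftrightarrow> x \<le> ?g * t + c" "t \<le> (?g - 1) * (x - c) \<longleftrightarrow> ?g * t + c \<le> x" for x t c
  proof -
    have e: "?g * ((?g - 1) * (x - c)) = x - c" using g(3) by (metis mult.assoc mult.commute mult_1)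
    show "(?g - 1) * (x - c) \<le> t \<longleftrightarrow> x \<le> ?g * t + c"
      using mult_le_cancel_left_pos[OF g(1), of "(?g - 1) * (x - c)" t] unfolding e by auto
    show "t \<le> (?g - 1) * (x - c) \<longleftrightarrow> ?g * t + c \<le> x"
      using mult_le_cancel_left_pos[OF g(1), of t "(?g - 1) * (x - c)"] unfolding e by auto
  qed
  have down: "?g * (x - c) \<le> t \<longleftrightarrow> x \<le> (?g - 1) * t + c" "t \<le> ?g * (x - c) \<longleftrightarrow> (?g - 1) * t + c \<le> x" for x t c
  proof -
    have e: "(?g - 1) * (?g * (x - c)) = x - c" using g(3) by (metis mult.assoc mult_1)
    show "?g * (x - c) \<le> t \<longleftrightarrow> x \<le> (?g - 1) * t + c"
      using mult_le_cancel_left_pos[OF g(2), of "?g * (x - c)" t] unfolding e by auto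
    show "t \<le> ?g * (x - c) \<longleftrightarrow> (?g - 1) * t + c \<le> x"
      using mult_le_cancel_left_pos[OF g(2), of t "?g * (x - c)"] unfolding e by auto
  qed
  have v: "golden_val (0, 1) = ?g" "golden_val (- 1, 1) = ?g - 1" by simp_all
  show ?thesis
    using assms
    unfolding p B half_turn_pullback.simps Let_def cA_def[symmetric] cD_def[symmetric] pull_interval.simps
      in_box_def form_vals_eq list.rel_inject list_all2_Cons prod.case golden_val_times golden_val_diff v
      up down div_by_1
    unfolding p[symmetric] forms by (simp add: algebra_simps)
qed

definition box_shift :: "golden_int list \<Rightarrow> box \<Rightarrow> box" where
  "box_shift fs B = map2 (\<lambda>f (l, u). (l - f, u - f)) fs B"

definition box_inter :: "box \<Rightarrow> box \<Rightarrow> box" where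
  "box_inter = map2 (\<lambda>(l, u) (l', u'). (if golden_le l l' then l' else l, if golden_le u u' then u else u'))"

lemma in_box_shift:
  assumes "in_box 1 (box_shift (forms t) B) (form_vals (s - t))" "length B = 4"
  shows "in_box 1 B (form_vals s)"
proof -
  obtain I1 I2 I3 I4 where B: "B = [I1, I2, I3, I4]"
    using assms(2) by (auto simp: length_Suc_conv numeral_eq_Suc)
  show ?thesis using assms(1)
    by (cases I1, cases I2, cases I3, cases I4, cases s, cases t)
      (auto simp: B in_box_def box_shift_def form_vals_def algebra_simps)
qed

lemma in_box_inter:
  assumes "in_box c (box_inter B B') xs" "length B = length B'"
  shows "in_box c B xs \<and> in_box c B' xs"
  using assms(2,1)
proof (induction B B' arbitrary: xs rule: list_induct2)
  case (Cons I B I' B')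
  then show ?case
    by (cases I, cases I')
      (auto simp: in_box_def box_inter_def list_all2_Cons1 golden_le_iff split: if_splits)
qed (simp add: box_inter_def)

text \<open>The box contains the points, relative to the starting point, whose first half turn is
  \<open>p\<close> and whose second is \<open>q\<close>.\<close>

fun full_turn :: "turn \<times> turn \<Rightarrow> move" where
  "full_turn (p, q) =
     (box_shift (forms start) (box_inter (half_turn_domain p) (half_turn_pullback p (half_turn_domain q))),
      half_turn q (half_turn p 0))"

text \<open>The linear part of a half turn is an involution, so two half turns translate.\<close>

lemma half_turn_twice: "half_turn q (half_turn p s) = s + half_turn q (half_turn p 0)"
  by (cases p, cases q, cases s) (simp add: zero_prod_def)

lemma length_half_turn_boxes:
  "length (half_turn_domain p) = 4" "length (half_turn_pullback p (half_turn_domain q)) = 4"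
  by (cases p, cases q, simp add: Let_def)+

lemma leads_full_turn: "leads 0 (full_turn pq)"
proof -
  obtain p q where pq: "pq = (p, q)" by (cases pq)
  let ?I = "box_inter (half_turn_domain p) (half_turn_pullback p (half_turn_domain q))"
  have len: "length ?I = 4" by (simp add: box_inter_def length_half_turn_boxes)
  show ?thesis
    unfolding leads_def pq full_turn.simps prod.case
  proof (intro allI impI)
    fix s
    assume s: "admissible s" "in_box (theta ^ 0) (box_shift (forms start) ?I) (form_vals (s - start))"
    have "in_box 1 ?I (form_vals s)" by (rule in_box_shift[OF _ len]) (use s(2) in simp)
    note inter = in_box_inter[OF this]
    have box: "in_box 1 (half_turn_domain p) (form_vals s)"
      "in_box 1 (half_turn_pullback p (half_turn_domain q)) (form_vals s)"
      using inter by (simp_all only: length_half_turn_boxes refl simp_thms)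
    have first: "reaches (location s) (location (half_turn p s)) \<and> admissible (half_turn p s)"
      by (rule half_turn_reaches_in_domain[OF s(1) box(1)])
    moreover have "reaches (location (half_turn p s)) (location (half_turn q (half_turn p s))) \<and>
        admissible (half_turn q (half_turn p s))"
      by (rule half_turn_reaches_in_domain[OF conjunct2[OF first] half_turn_pullback_in_box[OF box(2)]])
    ultimately show "reaches (location s) (location (s + (expand ^^ 0) (half_turn q (half_turn p 0)))) \<and>
        admissible (s + (expand ^^ 0) (half_turn q (half_turn p 0)))"
      unfolding funpow_0 half_turn_twice[of q p s, symmetric] by (auto intro: rtranclp_trans)
  qed
qed

section \<open>The self-similar return map\<close>

text \<open>The full turns that are needed to describe the orbit near its starting point, each as a pair of
  half turns.\<close>

definition full_turns :: "(turn \<times> turn) list" where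
  "full_turns =
    [((-1, 0, -2, -2), (-1, 0, -1, 0)),
     ((0, 0, -1, -2), (0, -1, -1, 0)),
     ((0, -1, -2, -2), (-1, -1, -2, 0)),
     ((-1, 0, -2, -2), (-1, 0, -2, -1)),
     ((-2, 1, -2, -1), (-1, -1, -2, 0)),
     ((0, -1, -2, -2), (-1, -1, -2, -1)),
     ((1, -2, -1, -1), (0, -1, -1, 0)),
     ((0, -1, -1, -1), (1, -2, -1, -1)),
     ((0, 0, -1, -1), (-2, 1, -2, -1)),
     ((-2, 1, -2, -1), (-1, 0, -2, -2)),
     ((-1, 0, -1, 0), (0, 0, -1, -2)),
     ((0, -1, -1, 0), (-1, 1, -1, -1)),
     ((-1, -1, -2, 0), (-1, 0, -2, -2)),
     ((-1, 0, -2, -1), (-2, 0, -2, 0)),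
     ((-1, 0, -2, -2), (0, -2, -2, -1)),
     ((0, -1, -1, 0), (0, -1, -2, -2)),
     ((-1, -1, -2, -1), (1, -2, -1, -1)),
     ((0, -1, -1, -1), (1, -1, -1, -2)),
     ((0, -1, -1, 0), (0, -1, -1, -1)),
     ((0, -2, -2, -1), (0, -1, -1, 0)),
     ((1, -2, -1, -1), (0, 0, -1, -2)),
     ((1, -1, -1, -2), (-1, 0, -1, 0)),
     ((-1, 1, -1, -1), (-1, 0, -2, -2)),
     ((-1, 0, -1, 0), (0, 0, -1, -1)),
     ((-2, 0, -2, 0), (0, -1, -2, -2)),
     ((-1, 0, -2, -1), (-2, 1, -2, -1))]"

text \<open>All boxes lie in the neighbourhood \<open>14\<phi> - 23 \<le> A \<le> 15 - 9\<phi>\<close>,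
  \<open>3 - 2\<phi> \<le> B \<le> 9\<phi> - 14\<close>, \<open>7\<phi> - 12 \<le> D \<le> 2 -
  \<phi>\<close> of the starting point, in relative forms, and the displacements bring them back
  into it: these are the returns of the orbit to this neighbourhood that enter into the
  substitution below. The piece with index 0 contains the starting point, and the displacement
  of the piece with index 16 takes a point of its box to the starting point.\<close>

definition pieces :: "move list" where
  "pieces =
    [([((21, -13), (5, -3)), ((76, -47), (-8, 5)), ((29, -18), (13, -8)), ((8, -5), (18, -11))],
       (0, 12, 20, 16)),
     ([((11, -7), (21, -13)), ((-8, 5), (18, -11)), ((23, -14), (49, -30)), ((-12, 7), (-2, 1))],
       (10, 0, 10, 8)),
     ([((-21, 13), (5, -3)), ((-40, 25), (-14, 9)), ((-9, 6), (17, -10)), ((-12, 7), (14, -9))],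
       (-10, 8, 2, 2)),
     ([((21, -13), (5, -3)), ((50, -31), (34, -21)), ((3, -2), (-13, 8)), ((18, -11), (2, -1))],
       (-16, 12, 4, 3)),
     ([((-21, 13), (5, -3)), ((18, -11), (44, -27)), ((-3, 2), (-19, 12)), ((24, -15), (8, -5))],
       (-26, 20, 6, 5)),
     ([((5, -3), (-11, 7)), ((-40, 25), (-14, 9)), ((33, -20), (59, -36)), ((-28, 17), (-2, 1))],
       (32, -12, 12, 10)),
     ([((37, -23), (63, -39)), ((-8, 5), (60, -37)), ((-3, 2), (65, -40)), ((-28, 17), (-2, 1))],
       (42, -12, 22, 18)),
     ([((21, -13), (-21, 13)), ((50, -31), (8, -5)), ((3, -2), (-39, 24)), ((60, -37), (18, -11))],
       (-42, 32, 10, 8)),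
     ([((-63, 39), (5, -3)), ((-24, 15), (44, -27)), ((-87, 54), (-19, 12)), ((-44, 27), (24, -15))],
       (-52, 20, -20, -16)),
     ([((21, -13), (-21, 13)), ((186, -115), (76, -47)), ((-81, 50), (-13, 8)), ((34, -21), (60, -37))],
       (-68, 52, 16, 13)),
     ([((-47, 29), (21, -13)), ((-60, 37), (8, -5)), ((71, -44), (29, -18)), ((-8, 5), (-50, 31))],
       (68, -40, 4, 3)),
     ([((11, -7), (-31, 19)), ((-8, 5), (-118, 73)), ((133, -82), (23, -14)), ((-12, 7), (-54, 33))],
       (36, -32, -16, -13)),
     ([((37, -23), (-5, 3)), ((-8, 5), (-118, 73)), ((65, -40), (-45, 28)), ((-28, 17), (-70, 43))],
       (68, -52, -16, -13)),
     ([((5, -3), (73, -45)), ((-82, 51), (-14, 9)), ((59, -36), (17, -10)), ((-12, 7), (-54, 33))],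
       (42, -32, -10, -8)),
     ([((5, -3), (31, -19)), ((2, -1), (28, -17)), ((7, -4), (33, -20)), ((-28, 17), (-2, 1))],
       (16, 0, 16, 13)),
     ([((-5, 3), (-47, 29)), ((18, -11), (-92, 57)), ((-87, 54), (-19, 12)), ((14, -9), (40, -25))],
       (-42, 20, -10, -8)),
     ([((-63, 39), (5, -3)), ((-66, 41), (2, -1)), ((-61, 38), (7, -4)), ((-2, 1), (66, -41))],
       (-52, 20, -20, -16)),
     ([((21, -13), (-267, 165)), ((18, -11), (-270, 167)), ((-443, 274), (-265, 164)), ((-2, 1), (176, -109))],
       (-42, -32, -94, -76)),
     ([((-63, 39), (5, -3)), ((-66, 41), (112, -69)), ((49, -30), (-61, 38)), ((-2, 1), (-44, 27))],
       (-26, 0, -26, -21)),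
     ([((-89, 55), (-131, 81)), ((18, -11), (-92, 57)), ((-45, 28), (-155, 96)), ((66, -41), (24, -15))],
       (-68, 20, -36, -29)),
     ([((-47, 29), (21, -13)), ((-50, 31), (18, -11)), ((-45, 28), (23, -14)), ((-70, 43), (-2, 1))],
       (52, -52, -32, -26)),
     ([((5, -3), (-105, 65)), ((-40, 25), (-150, 93)), ((33, -20), (101, -62)), ((-96, 59), (-28, 17))],
       (58, -52, -26, -21)),
     ([((-215, 133), (-37, 23)), ((-480, 297), (-14, 9)), ((-51, 32), (-339, 210)), ((124, -77), (14, -9))],
       (42, -84, -94, -76)),
     ([((5, -3), (-37, 23)), ((-150, 93), (-82, 51)), ((-77, 48), (-9, 6)), ((14, -9), (-28, 17))],
       (16, -32, -36, -29)),
     ([((-21, 13), (-63, 39)), ((-92, 57), (-134, 83)), ((-155, 96), (-19, 12)), ((-44, 27), (24, -15))],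
       (16, -20, -16, -13)),
     ([((79, -49), (-31, 19)), ((-8, 5), (-118, 73)), ((-45, 28), (23, -14)), ((-54, 33), (14, -9))],
       (78, -84, -58, -47)),
     ([((-199, 123), (-131, 81)), ((-270, 167), (-92, 57)), ((-155, 96), (-265, 164)), ((66, -41), (24, -15))],
       (-94, 20, -62, -50)),
     ([((21, -13), (47, -29)), ((118, -73), (76, -47)), ((-39, 24), (-81, 50)), ((102, -63), (18, -11))],
       (-32, 12, -12, -10)),
     ([((-267, 165), (-199, 123)), ((18, -11), (-92, 57)), ((-155, 96), (-87, 54)), ((-2, 1), (-44, 27))],
       (-16, -52, -100, -81))]"

text \<open>How the displacement of each piece is composed of full turns.\<close>

definition turn_words :: "nat list list" where
  "turn_words =
    [[0, 1, 2, 3, 4, 0, 1, 5, 6, 2],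
     [0, 1, 7, 1, 2],
     [0, 8],
     [0, 1, 2, 3, 9, 10, 11],
     [0, 8, 12, 13, 2, 0, 8],
     [14, 15, 16, 1, 17, 10, 18, 6, 2, 0, 1, 7, 1, 2, 0, 8],
     [0, 1, 7, 15, 12, 19, 5, 20, 18, 21, 1, 5, 6, 2, 0, 1, 7, 1, 2, 0, 8],
     [0, 1, 2, 3, 4, 0, 1, 22, 23, 4, 3, 24, 12, 25],
     [0, 8, 12, 13, 2, 3, 9, 10, 15, 12, 25, 12, 10, 15, 16, 15, 12, 23, 4, 3, 24, 12, 25],
     [0, 1, 2, 3, 4, 0, 1, 22, 23, 4, 3, 24, 12, 23, 9, 10, 15, 12, 25, 0, 1, 22, 23, 4, 0, 1,
      7, 1, 2, 0, 8],
     [0, 1, 5, 20, 18, 21, 1, 7, 15, 12, 10, 18, 20, 15, 12, 19, 5, 20, 18, 21, 1, 5, 6, 2],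
     [0, 1, 7, 15, 12, 19, 5, 20, 15, 12, 25, 12, 10, 15, 16, 15, 12, 10, 18, 6, 2],
     [0, 1, 7, 15, 12, 19, 5, 20, 18, 21, 1, 7, 15, 12, 10, 18, 20, 15, 12, 23, 9, 10, 15, 16,
      1, 17, 10, 18, 6, 2],
     [14, 15, 16, 1, 17, 10, 15, 16, 15, 12, 10, 18, 6, 2],
     [14, 15, 16, 1, 2, 3, 4, 0, 1, 5, 6, 2],
     [0, 8, 12, 13, 2, 3, 9, 10, 15, 12, 25, 12, 10, 11],
     [0, 8, 12, 10, 18, 20, 15, 12, 23, 9, 10, 15, 12, 25, 0, 1, 22, 23, 4, 3, 24, 12, 25],
     [0, 8, 12, 13, 2, 3, 9, 10, 15, 12, 25, 12, 10, 15, 16, 15, 12, 10, 18, 20, 15, 12, 23, 9,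
      10, 15, 12, 25, 0, 1, 22, 23, 4, 3, 24, 12, 23, 9, 10, 15, 12, 25, 12, 10, 15, 16, 15, 12,
      10, 18, 20, 15, 12, 19, 5, 20, 18, 21, 1, 7, 15, 12, 10, 18, 20, 15, 12, 23, 9, 10, 15,
      12, 25, 12, 10, 11],
     [0, 8, 12, 10, 18, 20, 15, 12, 23, 9, 10, 15, 12, 25, 12, 10, 11],
     [0, 8, 12, 13, 2, 3, 9, 10, 15, 12, 25, 12, 10, 15, 16, 15, 12, 10, 18, 20, 15, 12, 23, 9,
      10, 15, 12, 25, 0, 1, 22, 23, 4, 3, 24, 12, 25],
     [0, 1, 7, 15, 12, 19, 5, 20, 18, 21, 1, 7, 15, 12, 10, 18, 20, 15, 12, 23, 9, 10, 15, 12,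
      25, 12, 10, 15, 16, 15, 12, 10, 18, 6, 2],
     [14, 15, 16, 1, 17, 10, 15, 16, 15, 12, 10, 18, 20, 15, 12, 23, 9, 10, 15, 16, 1, 17, 10,
      18, 6, 2],
     [14, 15, 16, 1, 17, 10, 15, 16, 15, 12, 10, 18, 20, 15, 12, 23, 9, 10, 15, 12, 25, 0, 1,
      22, 23, 4, 3, 24, 12, 23, 9, 10, 15, 12, 25, 12, 10, 15, 16, 15, 12, 10, 18, 20, 15, 12,
      19, 5, 20, 18, 21, 1, 7, 15, 12, 10, 18, 20, 15, 12, 23, 9, 10, 15, 12, 25, 12, 10, 15,
      16, 15, 12, 10, 18, 6, 2],
     [14, 15, 16, 1, 17, 10, 15, 16, 15, 12, 10, 18, 20, 15, 12, 23, 9, 10, 15, 12, 25, 12, 10,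
      11],
     [0, 8, 12, 13, 2, 3, 9, 10, 15, 12, 25, 12, 10, 15, 16, 15, 12, 10, 18, 20, 15, 12, 19, 5,
      20, 18, 21, 1, 5, 6, 2],
     [0, 1, 7, 15, 12, 19, 5, 20, 15, 12, 25, 12, 10, 15, 16, 15, 12, 10, 18, 20, 15, 12, 19, 5,
      20, 18, 21, 1, 7, 15, 12, 10, 18, 20, 15, 12, 23, 9, 10, 15, 12, 25, 12, 10, 15, 16, 15,
      12, 10, 18, 6, 2],
     [0, 8, 12, 13, 2, 3, 9, 10, 15, 12, 25, 12, 10, 15, 16, 15, 12, 10, 18, 20, 15, 12, 23, 9,
      10, 15, 12, 25, 0, 1, 22, 23, 4, 3, 24, 12, 23, 9, 10, 15, 12, 25, 12, 10, 15, 16, 15, 12,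
      23, 4, 3, 24, 12, 25],
     [0, 1, 2, 3, 4, 0, 1, 22, 23, 4, 3, 24, 12, 23, 9, 10, 15, 12, 25, 12, 10, 15, 16, 15, 12,
      10, 18, 6, 2],
     [0, 8, 12, 13, 2, 3, 9, 10, 15, 12, 25, 12, 10, 15, 16, 15, 12, 10, 18, 20, 15, 12, 23, 9,
      10, 15, 12, 25, 0, 1, 22, 23, 4, 3, 24, 12, 23, 9, 10, 15, 12, 25, 12, 10, 15, 16, 15, 12,
      10, 18, 20, 15, 12, 19, 5, 20, 18, 21, 1, 7, 15, 12, 10, 18, 20, 15, 12, 23, 9, 10, 15,
      12, 25, 12, 10, 15, 16, 15, 12, 10, 18, 6, 2]]"

text \<open>How the contracted displacement of each piece is composed of displacements of pieces: the
  substitution behind the self-similarity.\<close>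

definition piece_words :: "nat list list" where
  "piece_words =
    [[0, 1, 2, 3, 4, 0, 1, 5],
     [0, 6],
     [7],
     [0, 1, 2, 3, 8],
     [9, 7],
     [10, 11, 5, 0, 6, 7],
     [0, 12, 1, 13, 14, 1, 5, 0, 6, 7],
     [0, 1, 2, 3, 4, 0, 15, 4, 3, 16],
     [9, 3, 17, 4, 3, 16],
     [0, 1, 2, 3, 4, 0, 15, 4, 3, 18, 19, 0, 15, 4, 0, 6, 7],
     [0, 1, 13, 14, 20, 21, 1, 13, 14, 1, 5],
     [0, 12, 1, 22, 5],
     [0, 12, 1, 13, 14, 20, 23, 24, 11, 5],
     [10, 25, 5],
     [10, 1, 2, 3, 4, 0, 1, 5],
     [9, 3, 26],
     [27, 23, 19, 0, 15, 4, 3, 16],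
     [9, 3, 28, 23, 19, 0, 15, 4, 3, 18, 28, 21, 1, 13, 14, 20, 23, 26],
     [27, 23, 26],
     [9, 3, 28, 23, 19, 0, 15, 4, 3, 16],
     [0, 12, 1, 13, 14, 20, 23, 28, 5],
     [10, 25, 23, 24, 11, 5],
     [10, 25, 23, 19, 0, 15, 4, 3, 18, 28, 21, 1, 13, 14, 20, 23, 28, 5],
     [10, 25, 23, 26],
     [9, 3, 28, 21, 1, 13, 14, 1, 5],
     [0, 12, 1, 22, 21, 1, 13, 14, 20, 23, 28, 5],
     [9, 3, 28, 23, 19, 0, 15, 4, 3, 18, 17, 4, 3, 16],
     [0, 1, 2, 3, 4, 0, 15, 4, 3, 18, 28, 5],
     [9, 3, 28, 23, 19, 0, 15, 4, 3, 18, 28, 21, 1, 13, 14, 20, 23, 28, 5]]"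

text \<open>The function \<open>f\<close> selects what the words spell: the pieces themselves, or the
  contracted pieces.\<close>

definition spells :: "move list \<Rightarrow> (move \<Rightarrow> move) \<Rightarrow> nat list list \<Rightarrow> move list \<Rightarrow> bool" where
  "spells ms f = list_all2 (\<lambda>w m. list_all (\<lambda>i. i < length ms) w \<and>
     (case f m of (B, d) \<Rightarrow> follows B 0 (map ((!) ms) w) d))"

lemma turn_words_spell: "spells (map full_turn full_turns) id turn_words pieces"
  by code_simp

lemma piece_words_spell: "spells pieces (\<lambda>(B, d). (contract_box B, expand d)) piece_words pieces"
  by code_simp

lemma spellsD:
  assumes "spells ms f ws ps" "m \<in> set ps"
  obtains w where "set w \<subseteq> set ms" "follows (fst (f m)) 0 w (snd (f m))"
proof -
  obtain u where u: "list_all (\<lambda>i. i < length ms) u" "case f m of (B, d) \<Rightarrow> follows B 0 (map ((!) ms) u) d"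
    using assms unfolding spells_def by (auto simp: list_all2_conv_all_nth in_set_conv_nth)
  show thesis
    by (rule that[of "map ((!) ms) u"]) (use u in \<open>auto simp: list_all_iff case_prod_unfold\<close>)
qed

text \<open>The words in full turns start the induction, the words in pieces carry it on.\<close>

lemma pieces_lead: "m \<in> set pieces \<Longrightarrow> leads k m"
proof (induction k arbitrary: m)
  case 0
  obtain B d where m: "m = (B, d)" by (cases m)
  obtain w where w: "set w \<subseteq> set (map full_turn full_turns)" "follows B 0 w d"
    using spellsD[OF turn_words_spell 0] by (auto simp: m)
  have turns: "leads 0 m'" if "m' \<in> set w" for m' using w(1) that leads_full_turn by auto
  show ?case unfolding leads_def m prod.case
  proof (intro allI impI)
    fix s assume s: "admissible s" "in_box (theta ^ 0) B (form_vals (s - start))"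
    have adm: "admissible (s + (expand ^^ 0) 0)" using s(1) by simp
    show "reaches (location s) (location (s + (expand ^^ 0) d)) \<and> admissible (s + (expand ^^ 0) d)"
      using follows_reaches[OF turns w(2) adm s(2)] by simp
  qed
next
  case (Suc k)
  obtain B d where m: "m = (B, d)" by (cases m)
  obtain w where w: "set w \<subseteq> set pieces" "follows (contract_box B) 0 w (expand d)"
    using spellsD[OF piece_words_spell Suc.prems] by (auto simp: m)
  show ?case unfolding m by (rule leads_Suc[OF _ w(2)]) (use w(1) Suc.IH in auto)
qed

section \<open>Escape along the scales\<close>

fun encloses :: "box \<Rightarrow> golden_int list \<Rightarrow> bool" where
  "encloses ((l, u) # B) (f # fs) \<longleftrightarrow> golden_le l f \<and> golden_le f u \<and> encloses B fs"
| "encloses [] [] \<longleftrightarrow> True"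
| "encloses _ _ \<longleftrightarrow> False"

text \<open>The displacement \<open>v\<close> is taken relative to the centre of the contraction, so its
  scaled version stays in the scaled box at every level.\<close>

lemma encloses_in_box:
  assumes "encloses B (forms v)"
  shows "in_box (theta ^ k) B (form_vals ((expand ^^ k) v))"
proof -
  have scaled: "encloses B fs \<Longrightarrow> in_box c B (map ((*) c) (map golden_val fs))" if "c \<noteq> 0" for c and fs
    using that by (induction B fs rule: encloses.induct) (auto simp: in_box_def golden_le_iff)
  show ?thesis
    unfolding form_vals_expand_pow unfolding form_vals_def
    by (rule scaled) (use assms theta_neg in auto)
qed

definition even_shift :: "strip_coords \<Rightarrow> bool" where
  "even_shift = (\<lambda>(a, b, y, z). even a \<and> even b \<and> even y)"

lemma even_shift_expand_pow: "even_shift v \<Longrightarrow> even_shift ((expand ^^ k) v)"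
  by (induction k) (auto simp: even_shift_def expand_def)

lemma admissible_start_add: "even_shift v \<Longrightarrow> admissible (start + v)"
  by (auto simp: even_shift_def admissible_def start_def)

lemma piece_reaches:
  assumes "(B, d) \<in> set pieces" "encloses B (forms v)" "even_shift v"
  shows "reaches (location (start + (expand ^^ k) v)) (location (start + (expand ^^ k) (v + d)))"
proof -
  have "in_box (theta ^ k) B (form_vals (start + (expand ^^ k) v - start))"
    using encloses_in_box[OF assms(2)] by simp
  moreover have "admissible (start + (expand ^^ k) v)"
    by (intro admissible_start_add even_shift_expand_pow assms(3))
  ultimately show ?thesis
    using pieces_lead[OF assms(1), of k]
    unfolding leads_def prod.case expand_pow_add add.assoc[symmetric] by blast
qed

definition abscissa :: "strip_coords \<Rightarrow> real" where
  "abscissa = (\<lambda>(a, b, y, z). a + b * golden_ratio)"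

lemma abscissa_add: "abscissa (s + t) = abscissa s + abscissa t"
  by (cases s, cases t) (simp add: abscissa_def algebra_simps)

text \<open>The abscissas of the displacements satisfy the recurrence \<open>X\<^sub>k\<^sub>+\<^sub>2 = 4
  X\<^sub>k\<^sub>+\<^sub>1 + X\<^sub>k\<close>.\<close>

lemma abscissa_expand_pow_ge:
  assumes "1 \<le> abscissa v" "2 \<le> abscissa (expand v)"
  shows "k + 1 \<le> abscissa ((expand ^^ k) v)"
proof -
  have "k + 1 \<le> abscissa ((expand ^^ k) v) \<and> k + 2 \<le> abscissa ((expand ^^ Suc k) v)"
  proof (induction k)
    case 0
    then show ?case using assms by simp
  next
    case (Suc k)
    have "abscissa ((expand ^^ Suc (Suc k)) v) =
        4 * abscissa ((expand ^^ Suc k) v) + abscissa ((expand ^^ k) v)"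
      by (simp add: expand_square abscissa_add)
    then show ?case using Suc by simp
  qed
  then show ?thesis by simp
qed

lemma far_points_unbounded:
  assumes "1 \<le> abscissa v" "2 \<le> abscissa (expand v)"
    and S: "\<And>k. location (start + (expand ^^ k) v) \<in> S"
  shows "\<not> bounded S"
proof
  assume "bounded S"
  then obtain M where M: "\<And>q. q \<in> S \<Longrightarrow> norm q \<le> M" by (auto simp: bounded_iff)
  obtain k :: nat where k: "M < k" using reals_Archimedean2 by blast
  have "abscissa start = 2 - golden_ratio" by (simp add: abscissa_def start_def)
  moreover have "location (start + (expand ^^ k) v) $ 1 = abscissa (start + (expand ^^ k) v)"
    by (cases "start + (expand ^^ k) v") (simp add: location_def abscissa_def)
  ultimately have "k \<le> location (start + (expand ^^ k) v) $ 1"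
    using abscissa_expand_pow_ge[OF assms(1,2), of k] golden_ratio_bounds by (simp add: abscissa_add)
  then show False
    using component_le_norm_cart[of "location (start + (expand ^^ k) v)" 1] M[OF S, of k] k by simp
qed

lemma location_start: "location start = vector [1 / golden_ratio ^ 2, - 1]"
proof -
  have "golden_ratio ^ 2 * (2 - golden_ratio) = 1"
    by (simp add: power2_eq_square golden_ratio_reduce algebra_simps)
  then have "1 / golden_ratio ^ 2 = 2 - golden_ratio"
    using golden_ratio_bounds by (simp add: field_simps)
  then show ?thesis by (simp add: location_def start_def)
qed

text \<open>The starting point lies in the box of piece 0 at all levels, so its orbit visits all the points
  that are displaced from it by the scaled displacements of this piece.\<close>

lemma forward_orbit_unbounded: "unbounded_orbit billiard (vector [1 / golden_ratio ^ 2, - 1])"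
proof (rule unbounded_orbit_of_reachable)
  show "y = y'" if "billiard x y" "billiard x y'" for x y y'
    using outer_billiards_unique[OF _ that] by (simp add: normalized_kite_def)
  have "pieces ! 0 \<in> set pieces" by (rule nth_mem) (simp add: pieces_def)
  moreover have "pieces ! 0 = (fst (pieces ! 0), (0, 12, 20, 16))" by (simp add: pieces_def)
  ultimately have mem: "(fst (pieces ! 0), (0, 12, 20, 16)) \<in> set pieces" by simp
  have reach: "reaches (location (start + (expand ^^ k) 0)) (location (start + (expand ^^ k) (0 + (0, 12, 20, 16))))" for k
  proof (rule piece_reaches[OF mem])
    show "encloses (fst (pieces ! 0)) (forms 0)" by code_simp
  qed (simp add: even_shift_def zero_prod_def)
  show "\<not> bounded {y. reaches (vector [1 / golden_ratio ^ 2, - 1]) y}"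
    unfolding location_start[symmetric]
  proof (rule far_points_unbounded[of "(0, 12, 20, 16)"])
    show "location (start + (expand ^^ k) (0, 12, 20, 16)) \<in> {y. reaches (location start) y}" for k
      using reach[of k] by (simp add: expand_pow_zero)
  qed (use golden_ratio_bounds in \<open>simp_all add: abscissa_def expand_def\<close>)
qed

text \<open>The point before the displacement of piece 16 ends at the starting point lies in the box of this
  piece, and so does its scaled version at all levels. These points have the starting point on
  their forward orbits.\<close>

lemma backward_orbit_unbounded: "unbounded_orbit (billiard\<inverse>\<inverse>) (vector [1 / golden_ratio ^ 2, - 1])"
proof (rule unbounded_orbit_of_reachable)
  show "y = y'" if "billiard\<inverse>\<inverse> x y" "billiard\<inverse>\<inverse> x y'" for x y y'
    using inverse_outer_billiards_unique[OF _ that] by (simp add: normalized_kite_def)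
  have "pieces ! 16 \<in> set pieces" by (rule nth_mem) (simp add: pieces_def)
  moreover have "pieces ! 16 = (fst (pieces ! 16), (- 52, 20, - 20, - 16))" by (simp add: pieces_def)
  ultimately have mem: "(fst (pieces ! 16), (- 52, 20, - 20, - 16)) \<in> set pieces" by simp
  have "reaches (location (start + (expand ^^ k) (52, - 20, 20, 16)))
      (location (start + (expand ^^ k) ((52, - 20, 20, 16) + (- 52, 20, - 20, - 16))))" for k
  proof (rule piece_reaches[OF mem])
    show "encloses (fst (pieces ! 16)) (forms (52, - 20, 20, 16))" by code_simp
  qed (simp add: even_shift_def)
  then have reach: "reaches (location (start + (expand ^^ k) (52, - 20, 20, 16))) (location start)" for k
    by (simp add: expand_pow_zero flip: zero_prod_def)
  show "\<not> bounded {y. (billiard\<inverse>\<inverse>)\<^sup>*\<^sup>* (vector [1 / golden_ratio ^ 2, - 1]) y}"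
    unfolding location_start[symmetric] rtranclp_conversep
  proof (rule far_points_unbounded[of "(52, - 20, 20, 16)"])
    show "location (start + (expand ^^ k) (52, - 20, 20, 16)) \<in> {y. reaches\<inverse>\<inverse> (location start) y}" for k
      using reach[of k] by simp
  qed (use golden_ratio_bounds in \<open>simp_all add: abscissa_def expand_def\<close>)
qed

section \<open>Unbounded orbits on the Penrose kite\<close>

theorem theorem1p1:
  fixes K :: "(real^2) set"
  assumes "is_penrose_kite K"
  shows "(\<exists>x. unbounded_orbit (outer_billiards K) x) \<and>
    (\<exists>!F. orientation_preserving_affine F \<and> F ` K = normalized_kite) \<and>
    (\<forall>F. orientation_preserving_affine F \<and> F ` K = normalized_kite \<longrightarrow>
      (let p = inv F (vector [1 / golden_ratio ^ 2, -1]) in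
        unbounded_orbit (outer_billiards K) p \<and>
        unbounded_orbit ((outer_billiards K)\<inverse>\<inverse>) p))"
proof -
  obtain F where F: "orientation_preserving_affine F" "F ` K = normalized_kite"
    by (rule penrose_kite_normalization_exists[OF assms]) (rule that)
  let ?q = "vector [1 / golden_ratio ^ 2, -1] :: real^2"
  have orbits: "unbounded_orbit (outer_billiards K) (inv G ?q)"
    "unbounded_orbit ((outer_billiards K)\<inverse>\<inverse>) (inv G ?q)"
    if G: "orientation_preserving_affine G" "G ` K = normalized_kite" for G
  proof -
    have iff: "billiard (G x) (G y) \<longleftrightarrow> outer_billiards K x y" for x y
      using outer_billiards_affine_iff[OF G(1), of K x y] by (simp add: G(2))
    show "unbounded_orbit (outer_billiards K) (inv G ?q)"
      by (rule unbounded_orbit_affine_preimage[OF G(1) _ forward_orbit_unbounded]) (simp add: iff)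
    show "unbounded_orbit ((outer_billiards K)\<inverse>\<inverse>) (inv G ?q)"
      by (rule unbounded_orbit_affine_preimage[OF G(1) _ backward_orbit_unbounded]) (simp add: iff)
  qed
  have "\<exists>x. unbounded_orbit (outer_billiards K) x" using orbits(1)[OF F] by blast
  moreover have "\<exists>!F. orientation_preserving_affine F \<and> F ` K = normalized_kite"
    using F normalization_unique by blast
  ultimately show ?thesis using orbits by (simp add: Let_def)
qed

end
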